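(* Let $(\mathfrak g,[\cdot,\cdot],\omega)$ be a symplectically irreducible $6$-dimensional symplectic Lie algebra. Then there exists a basis $\{\hat e_k\}_{1\le k\le 6}$ of $\mathfrak g$ such that $$[\hat e_1,\hat e_3]=\hat e_4,\quad [\hat e_1,\hat e_4]=-\hat e_3,\quad [\hat e_2,\hat e_5]=\hat e_6,\quad [\hat e_2,\hat e_6]=-\hat e_5$$ are (up to skew-symmetry) the only nonzero Lie brackets of basis elements of $(\mathfrak g,[\cdot,\cdot])$.
   Context: All Lie algebras are real and finite-dimensional. A symplectic Lie algebra $(\mathfrak g,[\cdot,\cdot],\omega)$ is a Lie algebra with a nondegenerate skew-symmetric bilinear form $\omega$ satisfying $\omega([x,y],z)+\omega([y,z],x)+\omega([z,x],y)=0$ for all $x,y,z\in\mathfrak g$. A subspace $\mathfrak m$ is isotropic if $\omega(x,y)=0$ for all $x,y\in\mathfrak m$. A symplectic Lie algebra is symplectically irreducible if it contains no nonzero isotropic ideal. *)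

theory Defs
  imports "HOL-Analysis.Analysis"
begin

locale lie_algebra =
  fixes bracket :: "'a::real_vector \<Rightarrow> 'a \<Rightarrow> 'a"
  assumes bilinear_bracket: "bilinear bracket"
    and bracket_self: "bracket x x = 0"
    and jacobi: "bracket x (bracket y z) + bracket y (bracket z x) + bracket z (bracket x y) = 0"

(* Finite-dimensionality is not part of the locale: it is assumed of the underlying vector
   space where needed, in the form dim UNIV = n with n > 0 (in an infinite-dimensional space
   dim UNIV = 0). *)
locale symplectic_lie_algebra = lie_algebra bracket
  for bracket :: "'a::real_vector \<Rightarrow> 'a \<Rightarrow> 'a" +
  fixes \<omega> :: "'a \<Rightarrow> 'a \<Rightarrow> real"
  assumes bilinear_form: "bilinear \<omega>"
    and form_skew: "\<omega> x y = - \<omega> y x"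
    and form_nondegenerate: "(\<And>y. \<omega> x y = 0) \<Longrightarrow> x = 0"
    and form_closed: "\<omega> (bracket x y) z + \<omega> (bracket y z) x + \<omega> (bracket z x) y = 0"

definition lie_ideal :: "('a::real_vector \<Rightarrow> 'a \<Rightarrow> 'a) \<Rightarrow> 'a set \<Rightarrow> bool" where
  "lie_ideal bracket I \<longleftrightarrow> subspace I \<and> (\<forall>x. \<forall>y\<in>I. bracket x y \<in> I)"

definition isotropic :: "('a::real_vector \<Rightarrow> 'a \<Rightarrow> real) \<Rightarrow> 'a set \<Rightarrow> bool" where
  "isotropic \<omega> M \<longleftrightarrow> (\<forall>x\<in>M. \<forall>y\<in>M. \<omega> x y = 0)"

definition symplectically_irreducible ::
    "('a::real_vector \<Rightarrow> 'a \<Rightarrow> 'a) \<Rightarrow> ('a \<Rightarrow> 'a \<Rightarrow> real) \<Rightarrow> bool" where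
  "symplectically_irreducible bracket \<omega> \<longleftrightarrow>
     symplectic_lie_algebra bracket \<omega> \<and>
     \<not> (\<exists>I. lie_ideal bracket I \<and> isotropic \<omega> I \<and> I \<noteq> {0})"

(* A basis indexed by {1..n}; injectivity excludes repeated vectors. *)
definition indexed_basis :: "nat \<Rightarrow> (nat \<Rightarrow> 'a::real_vector) \<Rightarrow> bool" where
  "indexed_basis n e \<longleftrightarrow>
     inj_on e {1..n} \<and> independent (e ` {1..n}) \<and> span (e ` {1..n}) = UNIV"

end

theory Submission
  imports Defs "HOL-Computational_Algebra.Fundamental_Theorem_Algebra"
begin

text \<open>
Write \<open>a\<^sup>\<bottom>\<close> for the \<open>\<omega>\<close>-orthogonal complement. The claim follows from a decomposition of the
algebra as \<open>a\<^sup>\<bottom> \<oplus> a\<close>, where \<open>a\<close> is an abelian ideal of dimension four and \<open>a\<^sup>\<bottom>\<close> an abelian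
subalgebra of dimension two acting on \<open>a\<close> by commuting rotations.

The first step is to find a nonzero abelian ideal. More generally, every nonzero ideal \<open>k\<close> of a
symplectic Lie algebra contains one (\<open>ideal_contains_abelian_ideal\<close>). Otherwise the Killing form
would be nondegenerate on \<open>k\<close>, and \<open>\<omega>\<close> would be given on \<open>k\<close> by a derivation of the algebra; this
derivation is inner, \<open>D = ad z\<close>, and \<open>z\<close> lies in the kernel of \<open>\<omega>\<close>, so \<open>\<omega>\<close> would vanish on \<open>k\<close>. The
nondegeneracy rests on the fact that an ideal in the kernel of the Killing form contains an abelian
ideal (\<open>abelian_ideal_in_killing_kernel\<close>), which combines Engel's theorem with Cartan's argument:
for an element \<open>u\<close> with \<open>T = ad u\<close> not nilpotent there is a derivation \<open>\<phi>\<close> with \<open>tr (\<phi> T) \<noteq> 0\<close>,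
obtained from the operator acting as the complex conjugate of the eigenvalue on each generalized
eigenspace of \<open>T\<close> (\<open>conjugate_derivation\<close>).

Let now \<open>a\<close> be a maximal abelian ideal. Irreducibility makes \<open>\<omega>\<close> nondegenerate on \<open>a\<close>, because the
radical of the restriction is an isotropic ideal. So the algebra is the sum of \<open>a\<close> and the subalgebra
\<open>a\<^sup>\<bottom>\<close>, which acts on \<open>a\<close> by symplectic maps, and it acts faithfully: its elements commuting with
\<open>a\<close> form an ideal, and an abelian ideal inside it could be added to \<open>a\<close>. In dimension six,
nondegenerate subspaces being even-dimensional, the pair \<open>(a\<^sup>\<bottom>, a)\<close> has dimensions \<open>(0, 6)\<close>,
\<open>(2, 4)\<close> or \<open>(4, 2)\<close>. In the first case the algebra is abelian and not irreducible, and the third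
contradicts faithfulness because \<open>sp(2)\<close> has dimension three. In the remaining case \<open>a\<^sup>\<bottom>\<close> is abelian
(\<open>transversal_commute\<close>), since a commutator acts on \<open>a\<close> by a nilpotent map, whose kernel is an
abelian ideal, hence nondegenerate, and therefore all of \<open>a\<close>.

Finally, the commuting maps have a common complex eigenvector in \<open>a\<close>. Its real and imaginary part
span a plane that is an ideal, so \<open>\<omega>\<close> is nonzero on it and both maps act on it as infinitesimal
rotations (\<open>rotation_plane\<close>). The orthogonal plane in \<open>a\<close> is of the same kind, and by faithfulness
the generators can be chosen to rotate one plane each.
\<close>

section \<open>Traces of operators\<close>

locale traced_space = finite_dimensional_vector_space scale Basis
  for scale :: "'a::field \<Rightarrow> 'b::ab_group_add \<Rightarrow> 'b" (infixr "\<odot>" 75) and Basis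
begin

text \<open>
Indexing by numbers rather than by a set lets repeated vectors count as a dependency, as needed
for the iterates \<open>v, T v, T (T v), \<dots>\<close> of an operator.
\<close>

lemma dependent_family:
  fixes f :: "nat \<Rightarrow> 'b"
  shows "\<exists>c. (\<exists>i\<le>dimension. c i \<noteq> 0) \<and> (\<Sum>i\<le>dimension. c i \<odot> f i) = 0"
proof (cases "inj_on f {..dimension}")
  case True
  have "dependent (f ` {..dimension})"
    using independent_card_le_dim[of "f ` {..dimension}" UNIV] card_image[OF True]
    by (auto simp: dimension_def)
  then obtain u where u: "\<exists>v\<in>f ` {..dimension}. u v \<noteq> 0" "(\<Sum>v\<in>f ` {..dimension}. u v \<odot> v) = 0"
    by (subst (asm) dependent_finite) auto
  then show ?thesis
    by (intro exI[of _ "u \<circ> f"]) (auto simp: sum.reindex[OF True])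
next
  case False
  then obtain i j where ij: "i \<le> dimension" "j \<le> dimension" "i \<noteq> j" "f i = f j"
    by (auto simp: inj_on_def)
  let ?c = "\<lambda>k. if k = i then 1 else if k = j then -1 else (0::'a)"
  have "(\<Sum>k\<le>dimension. ?c k \<odot> f k) = (\<Sum>k\<in>{i,j}. ?c k \<odot> f k)"
    using ij by (intro sum.mono_neutral_right) auto
  also have "\<dots> = 0" using ij by simp
  finally show ?thesis using ij by (intro exI[of _ ?c]) auto
qed

definition op_trace :: "('b \<Rightarrow> 'b) \<Rightarrow> 'a" where
  "op_trace f = (\<Sum>b\<in>Basis. representation Basis (f b) b)"

text \<open>
Expanding along both bases turns either side into the same double sum of products of matrix
entries. Taking \<open>g\<close> to be the identity gives independence of the basis, taking \<open>B = C\<close> gives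
\<open>tr (f g) = tr (g f)\<close>.
\<close>

lemma trace_wrt_two_bases:
  assumes f: "Vector_Spaces.linear scale scale f" and g: "Vector_Spaces.linear scale scale g"
    and B: "finite B" "independent B" "span B = UNIV"
    and C: "finite C" "independent C" "span C = UNIV"
  shows "(\<Sum>b\<in>B. representation B (f (g b)) b) = (\<Sum>c\<in>C. representation C (g (f c)) c)"
proof -
  have expand: "representation B (f (g b)) b
      = (\<Sum>c\<in>C. representation C (g b) c * representation B (f c) b)"
    if B: "independent B" "span B = UNIV" and C: "finite C" "independent C" "span C = UNIV"
      and f: "Vector_Spaces.linear scale scale f" for b f g and B C :: "'b set"
  proof -
    interpret f: Vector_Spaces.linear scale scale f by (rule f)
    have "f (g b) = f (\<Sum>c\<in>C. representation C (g b) c \<odot> c)"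
      using C by (subst sum_representation_eq) auto
    also have "\<dots> = (\<Sum>c\<in>C. representation C (g b) c \<odot> f c)"
      by (simp add: f.sum f.scale)
    finally show ?thesis
      using B by (simp add: representation_sum representation_scale)
  qed
  have "(\<Sum>b\<in>B. representation B (f (g b)) b)
      = (\<Sum>b\<in>B. \<Sum>c\<in>C. representation C (g b) c * representation B (f c) b)"
    using expand[OF B(2,3) C f] by simp
  also have "\<dots> = (\<Sum>c\<in>C. \<Sum>b\<in>B. representation B (f c) b * representation C (g b) c)"
    by (subst sum.swap) (simp add: mult.commute)
  also have "\<dots> = (\<Sum>c\<in>C. representation C (g (f c)) c)"
    using expand[OF C(2,3) B g] by simp
  finally show ?thesis .
qed

lemma op_trace_wrt:
  assumes f: "Vector_Spaces.linear scale scale f"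
    and C: "finite C" "independent C" "span C = UNIV"
  shows "op_trace f = (\<Sum>c\<in>C. representation C (f c) c)"
  unfolding op_trace_def
  using trace_wrt_two_bases[OF f linear_ident finite_Basis independent_Basis span_Basis C]
  by simp

lemma op_trace_comm:
  assumes f: "Vector_Spaces.linear scale scale f" and g: "Vector_Spaces.linear scale scale g"
  shows "op_trace (\<lambda>x. f (g x)) = op_trace (\<lambda>x. g (f x))"
  unfolding op_trace_def
  by (rule trace_wrt_two_bases[OF f g]) (auto simp: finite_Basis independent_Basis span_Basis)

lemma op_trace_add: "op_trace (\<lambda>x. f x + g x) = op_trace f + op_trace g"
  by (simp add: op_trace_def representation_add independent_Basis span_Basis sum.distrib)

lemma op_trace_diff: "op_trace (\<lambda>x. f x - g x) = op_trace f - op_trace g"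
  by (simp add: op_trace_def representation_diff independent_Basis span_Basis sum_subtractf)

lemma op_trace_scale: "op_trace (\<lambda>x. c \<odot> f x) = c * op_trace f"
  by (simp add: op_trace_def representation_scale independent_Basis span_Basis sum_distrib_left)

text \<open>
In a basis that extends a basis of \<open>W\<close> the matrix of such a map has a single nonzero block, which
lies off the diagonal.
\<close>

lemma op_trace_square_zero:
  assumes f: "Vector_Spaces.linear scale scale f" and W: "subspace W"
    and im: "\<And>x. f x \<in> W" and ker: "\<And>x. x \<in> W \<Longrightarrow> f x = 0"
  shows "op_trace f = 0"
proof -
  obtain C0 where C0: "C0 \<subseteq> W" "independent C0" "W \<subseteq> span C0"
    using maximal_independent_subset by blast
  let ?C = "extend_basis C0"
  have C: "C0 \<subseteq> ?C" "independent ?C" "span ?C = UNIV"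
    using extend_basis_superset[OF C0(2)] independent_extend_basis[OF C0(2)]
      span_extend_basis[OF C0(2)] by auto
  have "representation ?C (f c) c = 0" if c: "c \<in> ?C" for c
  proof (cases "c \<in> C0")
    case True
    then show ?thesis using C0 ker by (auto simp: representation_zero)
  next
    case False
    have "f c \<in> span C0" using im C0 by auto
    then have "representation ?C (f c) = representation C0 (f c)"
      by (rule representation_extend[OF C(2) _ C(1)])
    then show ?thesis using False representation_ne_zero by metis
  qed
  then show ?thesis
    using op_trace_wrt[OF f _ C(2,3)] finiteI_independent[OF C(2)] by simp
qed

end

section \<open>Generalized eigenspaces and derivations over the complex numbers\<close>

locale complex_space = traced_space scale Basis
  for scale :: "complex \<Rightarrow> 'b::ab_group_add \<Rightarrow> 'b" (infixr "\<odot>" 75) and Basis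
begin

text \<open>
If \<open>\<mu>\<close> is a root of \<open>p\<close>, then either \<open>(T - \<mu>) v\<close> lies in \<open>W\<close> and \<open>v\<close> is the vector sought, or
\<open>(T - \<mu>) v\<close> is a vector outside \<open>W\<close> that is annihilated by the quotient of \<open>p\<close> by \<open>X - \<mu>\<close>.
\<close>

lemma relative_eigenvector_poly:
  assumes lin: "Vector_Spaces.linear scale scale T"
    and Z: "subspace Z" "\<And>z. z \<in> Z \<Longrightarrow> T z \<in> Z" and W: "subspace W"
    and "p \<noteq> 0" "v \<in> Z" "v \<notin> W" "(\<Sum>i\<le>degree p. coeff p i \<odot> (T ^^ i) v) = 0"
  shows "\<exists>w \<mu>. w \<in> Z \<and> w \<notin> W \<and> T w - \<mu> \<odot> w \<in> W"
  using assms(5-)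
proof (induction "degree p" arbitrary: p v)
  case 0
  then have "coeff p 0 \<noteq> 0" using leading_coeff_0_iff[of p] by auto
  then have "v = 0" using 0 by auto
  then show ?case using 0 subspace_0[OF W] by auto
next
  case (Suc d)
  interpret T: Vector_Spaces.linear scale scale T by (rule lin)
  have "\<not> constant (poly p)" using Suc(2) by (simp add: constant_degree)
  then obtain \<mu> where "poly p \<mu> = 0" using fundamental_theorem_of_algebra by blast
  then obtain q where q: "p = [:-\<mu>, 1:] * q" by (metis dvdE poly_eq_0_iff_dvd)
  have q0: "q \<noteq> 0" using q Suc(3) by auto
  have dq: "d = degree q" using Suc(2) q q0 by (simp add: degree_mult_eq del: mult_pCons_left)
  define w where "w = T v - \<mu> \<odot> v"
  have wZ: "w \<in> Z" unfolding w_def using Z Suc(4) by (simp add: subspace_diff subspace_scale)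
  have pow: "(T ^^ i) w = (T ^^ Suc i) v - \<mu> \<odot> (T ^^ i) v" for i
    by (induction i) (simp_all add: w_def T.diff T.scale)
  have "coeff p i = (case i of 0 \<Rightarrow> 0 | Suc j \<Rightarrow> coeff q j) - \<mu> * coeff q i" for i
    unfolding q by (simp add: coeff_pCons split: nat.split)
  then have "(\<Sum>i\<le>Suc d. coeff p i \<odot> (T ^^ i) v) =
     (\<Sum>i\<le>Suc d. (case i of 0 \<Rightarrow> 0 | Suc j \<Rightarrow> coeff q j) \<odot> (T ^^ i) v)
      - (\<Sum>i\<le>Suc d. (\<mu> * coeff q i) \<odot> (T ^^ i) v)"
    by (simp only: scale_left_diff_distrib sum_subtractf)
  also have "(\<Sum>i\<le>Suc d. (case i of 0 \<Rightarrow> 0 | Suc j \<Rightarrow> coeff q j) \<odot> (T ^^ i) v)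
      = (\<Sum>i\<le>d. coeff q i \<odot> (T ^^ Suc i) v)"
    by (subst sum.atMost_Suc_shift) simp
  also have "(\<Sum>i\<le>Suc d. (\<mu> * coeff q i) \<odot> (T ^^ i) v) = (\<Sum>i\<le>d. coeff q i \<odot> \<mu> \<odot> (T ^^ i) v)"
    using dq by (simp add: coeff_eq_0 mult.commute)
  finally have "(\<Sum>i\<le>d. coeff q i \<odot> (T ^^ i) w) = 0"
    using Suc(2,6) unfolding pow by (simp add: sum_subtractf scale_right_diff_distrib)
  then show ?case
    using Suc(1)[OF dq q0 wZ] dq Suc(4,5) w_def by auto
qed

text \<open>
An eigenvector of \<open>T\<close> modulo \<open>W\<close>, stated without quotient spaces. With \<open>W = {0}\<close> it is an
eigenvector inside an invariant subspace; with \<open>W\<close> the sum of the generalized eigenspaces it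
shows that this sum is everything.
\<close>

lemma relative_eigenvector:
  assumes lin: "Vector_Spaces.linear scale scale T"
    and Z: "subspace Z" "\<And>z. z \<in> Z \<Longrightarrow> T z \<in> Z" and W: "subspace W"
    and v: "v \<in> Z" "v \<notin> W"
  obtains w \<mu> where "w \<in> Z" "w \<notin> W" "T w - \<mu> \<odot> w \<in> W"
proof -
  obtain c where c: "\<exists>i\<le>dimension. c i \<noteq> 0" "(\<Sum>i\<le>dimension. c i \<odot> (T ^^ i) v) = 0"
    using dependent_family[of "\<lambda>i. (T ^^ i) v"] by auto
  define p where "p = (\<Sum>i\<le>dimension. monom (c i) i)"
  have cp: "coeff p k = (if k \<le> dimension then c k else 0)" for k
    by (simp add: p_def coeff_sum)
  have "p \<noteq> 0" using c(1) cp by (metis coeff_0)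
  have "degree p \<le> dimension" by (rule degree_le) (simp add: cp)
  then have "(\<Sum>i\<le>degree p. coeff p i \<odot> (T ^^ i) v) = (\<Sum>i\<le>dimension. coeff p i \<odot> (T ^^ i) v)"
    by (intro sum.mono_neutral_left) (auto simp: coeff_eq_0)
  also have "\<dots> = 0" using c(2) by (simp add: cp)
  finally show ?thesis
    using relative_eigenvector_poly[OF lin Z W \<open>p \<noteq> 0\<close> v] that by auto
qed

definition shift :: "('b \<Rightarrow> 'b) \<Rightarrow> complex \<Rightarrow> 'b \<Rightarrow> 'b" where
  "shift T \<mu> x = T x - \<mu> \<odot> x"

definition gen_eigenspace :: "('b \<Rightarrow> 'b) \<Rightarrow> complex \<Rightarrow> 'b set" where
  "gen_eigenspace T \<mu> = {x. \<exists>n. (shift T \<mu> ^^ n) x = 0}"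

lemma gen_eigenspace_induct [consumes 1, case_names zero step]:
  assumes "x \<in> gen_eigenspace T \<mu>" "P 0"
    "\<And>x. x \<in> gen_eigenspace T \<mu> \<Longrightarrow> shift T \<mu> x \<in> gen_eigenspace T \<mu> \<Longrightarrow> P (shift T \<mu> x) \<Longrightarrow> P x"
  shows "P x"
proof -
  have "(shift T \<mu> ^^ n) x = 0 \<Longrightarrow> P x" for n
  proof (induction n arbitrary: x)
    case 0 then show ?case using assms(2) by simp
  next
    case (Suc n)
    then have "(shift T \<mu> ^^ n) (shift T \<mu> x) = 0" by (simp add: funpow_swap1)
    then show ?case using Suc assms(3)[of x] unfolding gen_eigenspace_def by blast
  qed
  then show ?thesis using assms(1) gen_eigenspace_def by auto
qed

lemma gen_eigenspace_step: "shift T \<mu> x \<in> gen_eigenspace T \<mu> \<Longrightarrow> x \<in> gen_eigenspace T \<mu>"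
  unfolding gen_eigenspace_def by (auto simp: funpow_swap1 intro: exI[of _ "Suc _"])

context
  fixes T assumes lin: "Vector_Spaces.linear scale scale T"
begin

interpretation T: Vector_Spaces.linear scale scale T by (rule lin)

lemma shift_simps:
  "shift T \<mu> 0 = 0" "shift T \<mu> (x + y) = shift T \<mu> x + shift T \<mu> y"
  "shift T \<mu> (x - y) = shift T \<mu> x - shift T \<mu> y"
  "shift T \<mu> (c \<odot> x) = c \<odot> shift T \<mu> x"
  by (simp_all add: shift_def T.add T.diff T.scale algebra_simps scale_right_distrib
      scale_right_diff_distrib)

lemma shift_power_simps:
  "(shift T \<mu> ^^ n) 0 = 0"
  "(shift T \<mu> ^^ n) (x + y) = (shift T \<mu> ^^ n) x + (shift T \<mu> ^^ n) y"
  "(shift T \<mu> ^^ n) (c \<odot> x) = c \<odot> (shift T \<mu> ^^ n) x"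
  by (induction n) (simp_all add: shift_simps)

lemma gen_eigenspace_zero: "0 \<in> gen_eigenspace T \<mu>"
  unfolding gen_eigenspace_def by (auto intro: exI[of _ 0])

lemma subspace_gen_eigenspace: "subspace (gen_eigenspace T \<mu>)"
proof (rule subspaceI)
  show "0 \<in> gen_eigenspace T \<mu>" by (rule gen_eigenspace_zero)
next
  fix x y assume "x \<in> gen_eigenspace T \<mu>" "y \<in> gen_eigenspace T \<mu>"
  then obtain m n where mn: "(shift T \<mu> ^^ m) x = 0" "(shift T \<mu> ^^ n) y = 0"
    unfolding gen_eigenspace_def by auto
  have "(shift T \<mu> ^^ (n + m)) x = 0" "(shift T \<mu> ^^ (m + n)) y = 0"
    using mn by (simp_all add: funpow_add shift_power_simps)
  then have "(shift T \<mu> ^^ (m + n)) (x + y) = 0"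
    by (simp add: shift_power_simps add.commute)
  then show "x + y \<in> gen_eigenspace T \<mu>" unfolding gen_eigenspace_def by auto
next
  fix c x assume "x \<in> gen_eigenspace T \<mu>"
  then show "c \<odot> x \<in> gen_eigenspace T \<mu>"
  proof (induction rule: gen_eigenspace_induct)
    case zero
    then show ?case by (simp add: gen_eigenspace_zero)
  next
    case (step x)
    then show ?case by (intro gen_eigenspace_step[of _ _ "c \<odot> x"]) (simp add: shift_simps)
  qed
qed

lemma shift_in_gen_eigenspace: "x \<in> gen_eigenspace T \<mu> \<Longrightarrow> shift T \<nu> x \<in> gen_eigenspace T \<mu>"
proof -
  assume x: "x \<in> gen_eigenspace T \<mu>"
  then have "shift T \<mu> x \<in> gen_eigenspace T \<mu>"
    by (induction rule: gen_eigenspace_induct) (auto simp: shift_simps gen_eigenspace_zero)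
  then have "shift T \<mu> x + (\<mu> - \<nu>) \<odot> x \<in> gen_eigenspace T \<mu>"
    using x subspace_gen_eigenspace subspace_add subspace_scale by blast
  then show ?thesis by (simp add: shift_def scale_left_diff_distrib)
qed

text \<open>
On the generalized eigenspace of \<open>\<mu>\<close> the operator \<open>T - \<nu>\<close> is the nonzero scalar \<open>\<mu> - \<nu>\<close> plus a
nilpotent operator, hence invertible; this lemma and the next give the two halves.
\<close>

lemma shift_surj_gen_eigenspace:
  assumes "x \<in> gen_eigenspace T \<mu>" "\<mu> \<noteq> \<nu>"
  shows "\<exists>y\<in>gen_eigenspace T \<mu>. shift T \<nu> y = x"
  using assms(1)
proof (induction rule: gen_eigenspace_induct)
  case zero then show ?case using gen_eigenspace_zero shift_simps by auto
next
  case (step x)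
  then obtain y where y: "y \<in> gen_eigenspace T \<mu>" "shift T \<nu> y = shift T \<mu> x" by auto
  let ?z = "inverse (\<mu> - \<nu>) \<odot> (x - y)"
  have "shift T \<nu> x - shift T \<mu> x = (\<mu> - \<nu>) \<odot> x" by (simp add: shift_def scale_left_diff_distrib)
  then have "shift T \<nu> ?z = x" using y assms(2) by (simp add: shift_simps)
  moreover have "?z \<in> gen_eigenspace T \<mu>"
    using y step subspace_gen_eigenspace subspace_scale subspace_diff by metis
  ultimately show ?case by blast
qed

lemma shift_inj_gen_eigenspace:
  assumes "x \<in> gen_eigenspace T \<mu>" "shift T \<nu> x = 0" "\<mu> \<noteq> \<nu>"
  shows "x = 0"
  using assms(1,2)
proof (induction rule: gen_eigenspace_induct)
  case zero then show ?case by simp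
next
  case (step x)
  have eq: "shift T \<mu> x = (\<nu> - \<mu>) \<odot> x"
    using step by (simp add: shift_def scale_left_diff_distrib)
  then have "shift T \<nu> (shift T \<mu> x) = 0" using step by (simp add: shift_simps)
  then have "shift T \<mu> x = 0" using step by blast
  then show ?case using eq assms(3) by simp
qed

lemma shift_power_inj_gen_eigenspace:
  assumes "x \<in> gen_eigenspace T \<mu>" "(shift T \<nu> ^^ n) x = 0" "\<mu> \<noteq> \<nu>"
  shows "x = 0"
  using assms(1,2)
proof (induction n arbitrary: x)
  case (Suc n)
  then have "shift T \<nu> x = 0"
    using shift_in_gen_eigenspace by (metis funpow_simps_right(2) o_apply)
  then show ?case using shift_inj_gen_eigenspace Suc assms(3) by blast
qed simp

text \<open>
Otherwise there is \<open>w\<close> outside the sum with \<open>(T - \<mu>) w\<close> in it. By the surjectivity of \<open>T - \<mu>\<close> on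
all other generalized eigenspaces, \<open>w\<close> can be corrected by an element of the sum so that
\<open>(T - \<mu>) w\<close> lies in the generalized eigenspace of \<open>\<mu>\<close>; but then so does \<open>w\<close>.
\<close>

lemma span_gen_eigenspaces: "span (\<Union>\<mu>. gen_eigenspace T \<mu>) = UNIV"
proof (rule ccontr)
  let ?W = "span (\<Union>\<mu>. gen_eigenspace T \<mu>)"
  assume "?W \<noteq> UNIV"
  then obtain v where "v \<notin> ?W" by auto
  then obtain w \<mu> where w: "w \<notin> ?W" "T w - \<mu> \<odot> w \<in> ?W"
    using relative_eigenvector[OF lin, of UNIV ?W v] by auto
  have "\<exists>z\<in>?W. shift T \<mu> z - x \<in> gen_eigenspace T \<mu>" if "x \<in> ?W" for x
    using that
  proof (induction rule: span_induct_alt)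
    case base
    then show ?case using span_zero by (auto intro!: bexI[of _ 0] simp: shift_simps gen_eigenspace_zero)
  next
    case (step c x y)
    from step(1) obtain \<nu> where x: "x \<in> gen_eigenspace T \<nu>" by auto
    from step obtain z where z: "z \<in> ?W" "shift T \<mu> z - y \<in> gen_eigenspace T \<mu>" by auto
    show ?case
    proof (cases "\<nu> = \<mu>")
      case True
      have "shift T \<mu> z - (c \<odot> x + y) = (shift T \<mu> z - y) - c \<odot> x" by simp
      also have "\<dots> \<in> gen_eigenspace T \<mu>"
        using x z True subspace_gen_eigenspace subspace_diff subspace_scale by metis
      finally show ?thesis using z by auto
    next
      case False
      then obtain x' where x': "x' \<in> gen_eigenspace T \<nu>" "shift T \<mu> x' = x"
        using shift_surj_gen_eigenspace[OF x] by auto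
      then have "shift T \<mu> (c \<odot> x' + z) - (c \<odot> x + y) \<in> gen_eigenspace T \<mu>"
        using z by (simp add: shift_simps)
      moreover have "c \<odot> x' + z \<in> ?W"
        using x' z by (intro span_add span_scale) (auto intro: span_base)
      ultimately show ?thesis by blast
    qed
  qed
  then obtain z where z: "z \<in> ?W" "shift T \<mu> z - (T w - \<mu> \<odot> w) \<in> gen_eigenspace T \<mu>"
    using w by blast
  then have "shift T \<mu> (z - w) \<in> gen_eigenspace T \<mu>" by (simp add: shift_simps) (simp add: shift_def)
  then have "z - w \<in> gen_eigenspace T \<mu>" by (rule gen_eigenspace_step)
  then have "z - w \<in> ?W" by (intro span_base) auto
  then have "z - (z - w) \<in> ?W" using z span_diff by blast
  then show False using w by simp
qed

text \<open>
A power of \<open>T - \<nu>\<close> removes the summand belonging to \<open>\<nu>\<close> and is injective on the generalized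
eigenspace of \<open>\<mu>\<close>, so the summands can be removed one at a time.
\<close>

lemma gen_eigenspaces_independent:
  assumes "finite S" "\<mu> \<notin> S" "x \<in> gen_eigenspace T \<mu>" "x \<in> span (\<Union>\<nu>\<in>S. gen_eigenspace T \<nu>)"
  shows "x = 0"
  using assms
proof (induction S arbitrary: x)
  case (insert \<nu> S)
  let ?G = "span (\<Union>\<nu>\<in>S. gen_eigenspace T \<nu>)"
  have "span (\<Union>\<nu>\<in>insert \<nu> S. gen_eigenspace T \<nu>) = {e + g | e g. e \<in> span (gen_eigenspace T \<nu>) \<and> g \<in> ?G}"
    by (simp add: span_Un)
  then obtain e g where eg: "e \<in> gen_eigenspace T \<nu>" "g \<in> ?G" "x = e + g"
    using insert(6) subspace_gen_eigenspace[of \<nu>, folded span_eq_iff] by auto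
  then obtain n where n: "(shift T \<nu> ^^ n) e = 0" unfolding gen_eigenspace_def by auto
  have inv: "(shift T \<nu> ^^ n) y \<in> gen_eigenspace T \<mu>" if "y \<in> gen_eigenspace T \<mu>" for y \<mu>
    using that by (induction n) (auto simp: shift_in_gen_eigenspace)
  have "(shift T \<nu> ^^ n) g \<in> ?G"
    using eg(2)
  proof (induction rule: span_induct_alt)
    case base
    then show ?case using span_zero by (simp add: shift_power_simps)
  next
    case (step c x y)
    then have "(shift T \<nu> ^^ n) x \<in> ?G" by (auto intro!: span_base inv)
    then show ?case using step by (simp add: shift_power_simps span_add span_scale)
  qed
  moreover have "(shift T \<nu> ^^ n) x = (shift T \<nu> ^^ n) g"
    using eg n by (simp add: shift_power_simps)
  ultimately have "(shift T \<nu> ^^ n) x = 0"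
    using insert.IH[of "(shift T \<nu> ^^ n) x"] insert.prems(1) inv[OF insert.prems(2)] by simp
  then show ?case using shift_power_inj_gen_eigenspace insert by auto
qed auto


text \<open>
A replacement for the Jordan normal form that suffices for traces: the conditions say that each
basis vector is a generalized eigenvector and that the diagonal entries of the matrix of \<open>T\<close> are
the eigenvalues. Such a basis is a maximal independent set with these properties whose span is
invariant. If it did not span, a generalized eigenvector outside the span could be moved by
\<open>T - \<mu>\<close> to the last place before it enters the span, and added.
\<close>

lemma triangular_gen_eigenspace_basis:
  obtains C m where "finite C" "independent C" "span C = UNIV"
    "\<And>c. c \<in> C \<Longrightarrow> c \<in> gen_eigenspace T (m c)"
    "\<And>c. c \<in> C \<Longrightarrow> T c - m c \<odot> c \<in> span (C - {c})"
proof -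
  define P where "P C \<longleftrightarrow> independent C \<and> (\<forall>c\<in>C. T c \<in> span C) \<and>
    (\<forall>c\<in>C. \<exists>\<mu>. c \<in> gen_eigenspace T \<mu> \<and> T c - \<mu> \<odot> c \<in> span (C - {c}))" for C
  have "P {}" by (simp add: P_def independent_empty)
  moreover have "\<forall>C. P C \<longrightarrow> card C < Suc dimension"
    using independent_card_le_dim[of _ UNIV] by (auto simp: P_def dimension_def less_Suc_eq_le)
  ultimately obtain C where C: "P C" and max: "\<And>D. P D \<Longrightarrow> card D \<le> card C"
    using ex_has_greatest_nat[of P "{}" card "Suc dimension"] by blast
  have fin: "finite C" using C finiteI_independent by (auto simp: P_def)
  have "span C = UNIV"
  proof (rule ccontr)
    assume "span C \<noteq> UNIV"
    then have "\<not> (\<Union>\<mu>. gen_eigenspace T \<mu>) \<subseteq> span C"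
      using span_gen_eigenspaces span_minimal[OF _ subspace_span] by blast
    then obtain \<mu> v where v: "v \<in> gen_eigenspace T \<mu>" "v \<notin> span C" by auto
    then have "\<exists>w\<in>gen_eigenspace T \<mu>. w \<notin> span C \<and> shift T \<mu> w \<in> span C"
      by (induction rule: gen_eigenspace_induct) (auto simp: span_zero)
    then obtain w where w: "w \<in> gen_eigenspace T \<mu>" "w \<notin> span C" "shift T \<mu> w \<in> span C" by blast
    have wC: "w \<notin> C" using w(2) span_base by blast
    have mono: "span C \<subseteq> span (insert w C)" by (rule span_mono) auto
    have "T w = shift T \<mu> w + \<mu> \<odot> w" by (simp add: shift_def)
    moreover have "shift T \<mu> w \<in> span (insert w C)" using w mono by blast
    ultimately have Tw: "T w \<in> span (insert w C)"
      by (simp add: span_add span_scale span_base)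
    have "P (insert w C)"
      unfolding P_def
    proof (intro conjI ballI)
      show "independent (insert w C)"
        using C w independent_insertI[of w C] by (auto simp: P_def)
      fix c assume c: "c \<in> insert w C"
      show "T c \<in> span (insert w C)"
        using c Tw C mono by (auto simp: P_def)
      show "\<exists>\<mu>. c \<in> gen_eigenspace T \<mu> \<and> T c - \<mu> \<odot> c \<in> span (insert w C - {c})"
      proof (cases "c = w")
        case True
        then show ?thesis using w wC by (auto simp: shift_def)
      next
        case False
        then have "c \<in> C" using c by auto
        then obtain \<nu> where "c \<in> gen_eigenspace T \<nu>" "T c - \<nu> \<odot> c \<in> span (C - {c})"
          using C by (auto simp: P_def)
        moreover have "span (C - {c}) \<subseteq> span (insert w C - {c})" by (rule span_mono) auto
        ultimately show ?thesis by blast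
      qed
    qed
    then show False using max[of "insert w C"] wC fin by simp
  qed
  moreover have "\<exists>m. \<forall>c\<in>C. c \<in> gen_eigenspace T (m c) \<and> T c - m c \<odot> c \<in> span (C - {c})"
    using C by (intro bchoice) (auto simp: P_def)
  ultimately show ?thesis using that fin C P_def by metis
qed

text \<open>
The heart of Cartan's criterion. Let \<open>F\<close> act on the generalized eigenspace of \<open>\<mu>\<close> as the scalar
\<open>cnj \<mu>\<close>. A derivation \<open>T\<close> satisfies \<open>[E\<^sub>\<mu>, E\<^sub>\<nu>] \<subseteq> E\<^sub>\<mu>\<^sub>+\<^sub>\<nu>\<close>, and conjugation is additive, so
\<open>F\<close> is a derivation too. In a triangular basis the diagonal entries of \<open>F T\<close> are the numbers
\<open>\<bar>\<mu>\<bar>\<^sup>2\<close>, so its trace is positive unless all eigenvalues vanish.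
\<close>

lemma conjugate_derivation:
  assumes add: "\<And>x y z. br (x + y) z = br x z + br y z" "\<And>x y z. br z (x + y) = br z x + br z y"
    and scale: "\<And>c x y. br (c \<odot> x) y = c \<odot> br x y" "\<And>c x y. br x (c \<odot> y) = c \<odot> br x y"
    and der: "\<And>x y. T (br x y) = br (T x) y + br x (T y)"
    and nonnil: "gen_eigenspace T 0 \<noteq> UNIV"
  obtains F where "Vector_Spaces.linear scale scale F"
    "\<And>x y. F (br x y) = br (F x) y + br x (F y)"
    "Re (op_trace (\<lambda>x. F (T x))) > 0"
proof -
  obtain C m where C: "finite C" "independent C" "span C = UNIV"
    and gen: "\<And>c. c \<in> C \<Longrightarrow> c \<in> gen_eigenspace T (m c)"
    and tri: "\<And>c. c \<in> C \<Longrightarrow> T c - m c \<odot> c \<in> span (C - {c})"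
    using triangular_gen_eigenspace_basis by blast
  interpret P: vector_space_pair scale scale ..
  obtain F where linF: "Vector_Spaces.linear scale scale F"
    and F: "\<And>c. c \<in> C \<Longrightarrow> F c = cnj (m c) \<odot> c"
    using P.linear_independent_extend[OF C(2), of "\<lambda>c. cnj (m c) \<odot> c"] by auto
  interpret F: Vector_Spaces.linear scale scale F by (rule linF)
  \<comment> \<open>\<open>F\<close> is prescribed only on the basis; independence of the generalized
    eigenspaces shows that it is a scalar on each of them.\<close>
  have Fgen: "F x = cnj \<mu> \<odot> x" if x: "x \<in> gen_eigenspace T \<mu>" for x \<mu>
  proof -
    let ?r = "representation C x"
    define x1 where "x1 = (\<Sum>c\<in>{c\<in>C. m c = \<mu>}. ?r c \<odot> c)"
    define x2 where "x2 = (\<Sum>c\<in>{c\<in>C. m c \<noteq> \<mu>}. ?r c \<odot> c)"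
    have "x = (\<Sum>c\<in>C. ?r c \<odot> c)" using C by (subst sum_representation_eq) auto
    also have "\<dots> = x1 + x2"
      unfolding x1_def x2_def using C(1)
      by (subst sum.union_disjoint[symmetric]) (auto intro: sum.cong)
    finally have xs: "x = x1 + x2" .
    have "x1 \<in> gen_eigenspace T \<mu>"
      unfolding x1_def using gen
      by (intro subspace_sum[OF subspace_gen_eigenspace] subspace_scale[OF subspace_gen_eigenspace]) auto
    then have "x2 \<in> gen_eigenspace T \<mu>"
      using xs x subspace_diff[OF subspace_gen_eigenspace, of x \<mu> x1] by simp
    moreover have "x2 \<in> span (\<Union>\<nu>\<in>m ` C - {\<mu>}. gen_eigenspace T \<nu>)"
      unfolding x2_def using gen by (intro span_sum span_scale span_base) auto
    ultimately have "x2 = 0"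
      using gen_eigenspaces_independent[of "m ` C - {\<mu>}" \<mu> x2] C(1) by auto
    then have "x = x1" using xs by simp
    moreover have "F x1 = cnj \<mu> \<odot> x1"
      unfolding x1_def by (auto simp: F.sum F.scale F scale_sum_right mult.commute intro!: sum.cong)
    ultimately show ?thesis by simp
  qed
  have br0: "br 0 y = 0" "br y 0 = 0" for y
    using scale(1)[of 0 0 y] scale(2)[of y 0 0] by auto
  have diff: "br (x - y) z = br x z - br y z" "br z (x - y) = br z x - br z y" for x y z
    using add(1)[of "x - y" y z] add(2)[of z "x - y" y] by (auto simp: algebra_simps)
  \<comment> \<open>Leibniz rule for \<open>T - (\<mu> + \<nu>)\<close>, by induction on both
    nilpotency orders.\<close>
  have grade: "br x y \<in> gen_eigenspace T (\<mu> + \<nu>)"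
    if "x \<in> gen_eigenspace T \<mu>" "y \<in> gen_eigenspace T \<nu>" for x y \<mu> \<nu>
    using that
  proof (induction arbitrary: y rule: gen_eigenspace_induct)
    case zero
    then show ?case by (simp add: br0 gen_eigenspace_zero)
  next
    case (step x)
    note IHx = step(3)
    show ?case
      using step(4)
    proof (induction rule: gen_eigenspace_induct)
      case zero
      then show ?case by (simp add: br0 gen_eigenspace_zero)
    next
      case (step y)
      have "shift T (\<mu> + \<nu>) (br x y) = br (shift T \<mu> x) y + br x (shift T \<nu> y)"
        by (simp add: shift_def der diff scale scale_left_distrib algebra_simps)
      also have "\<dots> \<in> gen_eigenspace T (\<mu> + \<nu>)"
        using step IHx subspace_add[OF subspace_gen_eigenspace] by blast
      finally show ?case by (rule gen_eigenspace_step)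
    qed
  qed
  have Fder: "F (br x y) = br (F x) y + br x (F y)" for x y
  proof -
    have basis: "F (br c d) = br (F c) d + br c (F d)" if "c \<in> C" "d \<in> C" for c d
      using Fgen[OF grade[OF gen gen]] F that by (simp add: scale scale_left_distrib)
    have left: "F (br c y) = br (F c) y + br c (F y)" if c: "c \<in> C" for c y
    proof -
      have "y \<in> span C" using C by simp
      then show ?thesis
        by (induction rule: span_induct_alt)
          (use basis[OF c] in \<open>auto simp: br0 add scale F.add F.scale scale_right_distrib algebra_simps\<close>)
    qed
    have "x \<in> span C" using C by simp
    then show ?thesis
      by (induction rule: span_induct_alt)
        (use left in \<open>auto simp: br0 add scale F.add F.scale scale_right_distrib algebra_simps\<close>)
  qed
  have "representation C (F (T c)) c = of_real ((cmod (m c))\<^sup>2)" if c: "c \<in> C" for c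
  proof -
    let ?u = "T c - m c \<odot> c"
    \<comment> \<open>\<open>F\<close> is diagonal in the basis, so the part of \<open>T c\<close>
      outside the line of \<open>c\<close> contributes nothing to the diagonal.\<close>
    have "F ` span (C - {c}) \<subseteq> span (C - {c})"
    proof -
      have "F x \<in> span (C - {c})" if "x \<in> span (C - {c})" for x
        using that
      proof (induction rule: span_induct_alt)
        case base
        then show ?case by (simp add: span_zero)
      next
        case (step a x y)
        then have "F x \<in> span (C - {c})" by (simp add: F span_scale span_base)
        then show ?case using step by (simp add: F.add F.scale span_add span_scale)
      qed
      then show ?thesis by auto
    qed
    then have "F ?u \<in> span (C - {c})" using tri[OF c] by auto
    then have "representation C (F ?u) = representation (C - {c}) (F ?u)"
      by (rule representation_extend[OF C(2)]) auto
    then have "representation C (F ?u) c = 0"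
      using representation_ne_zero[of "C - {c}" "F ?u" c] by auto
    moreover have "F (T c) = F ?u + (m c * cnj (m c)) \<odot> c"
      by (simp add: F.diff F.scale F c)
    ultimately show ?thesis
      using C c by (simp add: representation_add representation_scale representation_basis
          complex_norm_square[symmetric])
  qed
  then have tr: "Re (op_trace (\<lambda>x. F (T x))) = (\<Sum>c\<in>C. (cmod (m c))\<^sup>2)"
    using op_trace_wrt[OF Vector_Spaces.linear_compose[OF lin linF, unfolded o_def] C] by simp
  have "\<exists>c\<in>C. m c \<noteq> 0"
  proof (rule ccontr)
    assume "\<not> ?thesis"
    then have "C \<subseteq> gen_eigenspace T 0" using gen by fastforce
    then show False using span_minimal[OF _ subspace_gen_eigenspace] C nonnil by blast
  qed
  then have "(\<Sum>c\<in>C. (cmod (m c))\<^sup>2) > 0"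
    using C(1) by (auto intro: sum_pos2)
  then show ?thesis using that linF Fder tr by metis
qed

end

end

section \<open>Real vector spaces and their complexification\<close>

locale real_space =
  fixes B :: "'a::real_vector set"
  assumes finite_B: "finite B" and independent_B: "independent B" and span_B: "span B = UNIV"

sublocale real_space \<subseteq> traced_space scaleR B
  rewrites "module.dependent (*\<^sub>R) = dependent"
    and "module.representation (*\<^sub>R) = representation"
    and "module.subspace (*\<^sub>R) = subspace"
    and "module.span (*\<^sub>R) = span"
    and "vector_space.extend_basis (*\<^sub>R) = extend_basis"
    and "vector_space.dim (*\<^sub>R) = dim"
    and "Vector_Spaces.linear (*\<^sub>R) (*\<^sub>R) = linear"
    and "Vector_Spaces.linear (*) (*\<^sub>R) = linear"
proof -
  show "traced_space (*\<^sub>R) B"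
    unfolding traced_space_def
    using finite_B independent_B span_B
    by (unfold_locales) (auto simp: dependent_raw_def span_raw_def)
qed (auto simp: dependent_raw_def representation_raw_def subspace_raw_def span_raw_def
    extend_basis_raw_def dim_raw_def linear_def real_scaleR_def[abs_def])

text \<open>
The pair \<open>(x, y)\<close> stands for \<open>x + \<i> y\<close> in the complexification.
\<close>

definition cscale :: "complex \<Rightarrow> 'a::real_vector \<times> 'a \<Rightarrow> 'a \<times> 'a" where
  "cscale c z = (Re c *\<^sub>R fst z - Im c *\<^sub>R snd z, Re c *\<^sub>R snd z + Im c *\<^sub>R fst z)"

lemma fst_cscale [simp]: "fst (cscale c z) = Re c *\<^sub>R fst z - Im c *\<^sub>R snd z"
  and snd_cscale [simp]: "snd (cscale c z) = Re c *\<^sub>R snd z + Im c *\<^sub>R fst z"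
  by (simp_all add: cscale_def)

lemma vector_space_cscale: "vector_space cscale"
  by unfold_locales (auto simp: prod_eq_iff algebra_simps)

lemma linear_complexify:
  assumes "linear T"
  shows "Vector_Spaces.linear cscale cscale (map_prod T T)"
  unfolding Vector_Spaces.linear_iff
  using assms
  by (auto simp: vector_space_cscale prod_eq_iff linear_add linear_diff linear_cmul)

context real_space
begin

lemma complexification: "complex_space cscale ((\<lambda>b. (b, 0)) ` B)"
proof -
  interpret C: vector_space cscale by (rule vector_space_cscale)
  let ?B = "(\<lambda>b. (b, 0::'a)) ` B"
  have inj: "inj_on (\<lambda>b. (b, 0::'a)) B" by (auto simp: inj_on_def)
  have sum: "(\<Sum>v\<in>?B. cscale (u v) v) = (\<Sum>b\<in>B. Re (u (b, 0)) *\<^sub>R b, \<Sum>b\<in>B. Im (u (b, 0)) *\<^sub>R b)" for u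
    by (simp add: sum.reindex[OF inj] prod_eq_iff fst_sum snd_sum)
  have "finite ?B" using finite_B by simp
  moreover have "\<not> C.dependent ?B"
  proof
    assume "C.dependent ?B"
    then obtain u where u: "\<exists>v\<in>?B. u v \<noteq> 0" "(\<Sum>v\<in>?B. cscale (u v) v) = 0"
      using C.dependent_finite[OF \<open>finite ?B\<close>] by auto
    then have "(\<Sum>b\<in>B. Re (u (b, 0)) *\<^sub>R b) = 0" "(\<Sum>b\<in>B. Im (u (b, 0)) *\<^sub>R b) = 0"
      unfolding sum by (auto simp: prod_eq_iff)
    then have "Re (u (b, 0)) = 0 \<and> Im (u (b, 0)) = 0" if "b \<in> B" for b
      using that independentD[OF independent_B finite_B subset_refl, of "\<lambda>b. Re (u (b, 0))"]
        independentD[OF independent_B finite_B subset_refl, of "\<lambda>b. Im (u (b, 0))"] by blast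
    then show False using u(1) by (auto simp: complex_eq_iff)
  qed
  moreover have "C.span ?B = UNIV"
  proof -
    have "(x, y) \<in> C.span ?B" for x y
    proof -
      have "(\<Sum>v\<in>?B. cscale (Complex (representation B x (fst v)) (representation B y (fst v))) v)
          = (x, y)"
        unfolding sum using sum_representation_eq[of B _ B] independent_B span_B finite_B by simp
      then show ?thesis
        by (metis (no_types, lifting) C.span_base C.span_scale C.span_sum)
    qed
    then show ?thesis by auto
  qed
  ultimately show ?thesis by unfold_locales auto
qed

text \<open>
The real part, restricted to real vectors, of a derivation of the complexified bracket is a
derivation of the real one. Applied to the conjugate derivation of the complexification of \<open>T\<close>
this gives \<open>\<phi>\<close>, and the real trace of \<open>\<phi> T\<close> is the real part of the complex trace.
\<close>

lemma nonnilpotent_derivation_pairing: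
  fixes br :: "'a \<Rightarrow> 'a \<Rightarrow> 'a"
  assumes br: "bilinear br" and T: "linear T"
    and der: "\<And>x y. T (br x y) = br (T x) y + br x (T y)"
    and nonnil: "\<And>n. (T ^^ n) x0 \<noteq> 0"
  obtains \<phi> where "linear \<phi>" "\<And>x y. \<phi> (br x y) = br (\<phi> x) y + br x (\<phi> y)"
    "op_trace (\<lambda>x. \<phi> (T x)) \<noteq> 0"
proof -
  let ?B = "(\<lambda>b. (b, 0::'a)) ` B"
  interpret C: complex_space cscale ?B by (rule complexification)
  define brC where
    "brC z w = (br (fst z) (fst w) - br (snd z) (snd w), br (fst z) (snd w) + br (snd z) (fst w))" for z w
  let ?T = "map_prod T T"
  have linT: "Vector_Spaces.linear cscale cscale ?T" using T by (rule linear_complexify)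
  note bil = bilinear_ladd[OF br] bilinear_radd[OF br] bilinear_lmul[OF br] bilinear_rmul[OF br]
    bilinear_lsub[OF br] bilinear_rsub[OF br] bilinear_lzero[OF br] bilinear_rzero[OF br]
  have "(?T ^^ n) (x0, 0) = ((T ^^ n) x0, 0)" for n
    by (induction n) (simp_all add: linear_0[OF T])
  moreover have "C.shift ?T 0 = ?T" by (simp add: C.shift_def[abs_def])
  ultimately have "(x0, 0) \<notin> C.gen_eigenspace ?T 0"
    using nonnil by (simp add: C.gen_eigenspace_def zero_prod_def)
  then have "C.gen_eigenspace ?T 0 \<noteq> UNIV" by auto
  then obtain F where F: "Vector_Spaces.linear cscale cscale F"
      "\<And>z w. F (brC z w) = brC (F z) w + brC z (F w)"
      "Re (C.op_trace (\<lambda>z. F (?T z))) > 0"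
    using C.conjugate_derivation[OF linT, of brC]
    by (auto simp: brC_def prod_eq_iff bil der linear_add[OF T] linear_diff[OF T] algebra_simps)
  interpret F: Vector_Spaces.linear cscale cscale F by (rule F)
  define \<phi> where "\<phi> x = fst (F (x, 0))" for x
  have "linear \<phi>"
  proof (rule linearI)
    show "\<phi> (x + y) = \<phi> x + \<phi> y" for x y
      using F.add[of "(x, 0)" "(y, 0)"] by (simp add: \<phi>_def)
    show "\<phi> (c *\<^sub>R x) = c *\<^sub>R \<phi> x" for c x
      using F.scale[of "of_real c" "(x, 0)"] by (simp add: \<phi>_def cscale_def)
  qed
  moreover have "\<phi> (br x y) = br (\<phi> x) y + br x (\<phi> y)" for x y
    using F(2)[of "(x, 0)" "(y, 0)"] by (simp add: \<phi>_def brC_def bil)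
  moreover have "Re (C.op_trace (\<lambda>z. F (?T z))) = op_trace (\<lambda>x. \<phi> (T x))"
  proof -
    have inj: "inj_on (\<lambda>b. (b, 0::'a)) B" by (auto simp: inj_on_def)
    have rep: "C.representation ?B z (b, 0)
        = Complex (representation B (fst z) b) (representation B (snd z) b)" for z b
    proof -
      define f where "f v = (if v \<in> ?B
        then Complex (representation B (fst z) (fst v)) (representation B (snd z) (fst v)) else 0)" for v
      have fin: "{v. f v \<noteq> 0} \<subseteq> ?B" by (auto simp: f_def)
      have "C.representation ?B z = f"
      proof (rule C.representation_eqI)
        show "C.independent ?B" "z \<in> C.span ?B"
          using C.independent_Basis C.span_Basis by auto
        show "f v \<noteq> 0 \<Longrightarrow> v \<in> ?B" for v using fin by blast
        show "finite {v. f v \<noteq> 0}" using fin C.finite_Basis finite_subset by blast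
        have "(\<Sum>v | f v \<noteq> 0. cscale (f v) v) = (\<Sum>v\<in>?B. cscale (f v) v)"
          using fin C.finite_Basis by (intro sum.mono_neutral_left) auto
        also have "\<dots> = z"
          by (simp add: f_def sum.reindex[OF inj] prod_eq_iff fst_sum snd_sum
              sum_representation_eq[of B _ B] independent_B span_B finite_B)
        finally show "(\<Sum>v | f v \<noteq> 0. cscale (f v) v) = z" .
      qed
      moreover have "representation B v b = 0" if "b \<notin> B" for v
        using that representation_ne_zero by blast
      ultimately show ?thesis by (cases "b \<in> B") (auto simp: f_def complex_eq_iff)
    qed
    show ?thesis
      unfolding C.op_trace_def op_trace_def
      by (simp add: sum.reindex[OF inj] rep \<phi>_def linear_0[OF T])
  qed
  ultimately show ?thesis using that F(3) by force
qed

text \<open>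
The vectors \<open>x\<close> and \<open>y\<close> are the real and the imaginary part of a common eigenvector of the
complexified operators, with eigenvalues \<open>a + \<i> a'\<close> and \<open>b + \<i> b'\<close>.
\<close>

lemma common_eigenplane:
  assumes W: "subspace W" "W \<noteq> {0}"
    and S: "linear S" "\<And>x. x \<in> W \<Longrightarrow> S x \<in> W"
    and T: "linear T" "\<And>x. x \<in> W \<Longrightarrow> T x \<in> W"
    and comm: "\<And>x. x \<in> W \<Longrightarrow> S (T x) = T (S x)"
  obtains x y a a' b b' where "x \<in> W" "y \<in> W" "x \<noteq> 0 \<or> y \<noteq> 0"
    "S x = a *\<^sub>R x - a' *\<^sub>R y" "S y = a' *\<^sub>R x + a *\<^sub>R y"
    "T x = b *\<^sub>R x - b' *\<^sub>R y" "T y = b' *\<^sub>R x + b *\<^sub>R y"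
proof -
  interpret C: complex_space cscale "(\<lambda>b. (b, 0::'a)) ` B" by (rule complexification)
  obtain w where w: "w \<in> W" "w \<noteq> 0" using W subspace_0[OF W(1)] by blast
  have z: "C.subspace {0}" by (simp add: C.subspace_def)
  let ?Z = "W \<times> W"
  have Z: "C.subspace ?Z"
    unfolding C.subspace_def using subspace_0[OF W(1)]
      subspace_add[OF W(1)] subspace_diff[OF W(1)] subspace_scale[OF W(1)]
    by (auto simp: cscale_def zero_prod_def)
  have wZ: "(w, 0) \<in> ?Z" "(w, 0::'a) \<notin> {0}" using w subspace_0[OF W(1)] by (auto simp: zero_prod_def)
  have SZ: "map_prod S S z \<in> ?Z" if "z \<in> ?Z" for z using that S(2) by auto
  obtain u \<mu> where u: "u \<in> ?Z" "u \<notin> {0}" "map_prod S S u - cscale \<mu> u \<in> {0}"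
    by (rule C.relative_eigenvector[OF linear_complexify[OF S(1)] Z SZ z wZ])
  \<comment> \<open>The eigenspace of the first operator is invariant under the second.\<close>
  let ?Y = "{z \<in> ?Z. map_prod S S z = cscale \<mu> z}"
  interpret S: Vector_Spaces.linear cscale cscale "map_prod S S" by (rule linear_complexify[OF S(1)])
  interpret T: Vector_Spaces.linear cscale cscale "map_prod T T" by (rule linear_complexify[OF T(1)])
  have Y: "C.subspace ?Y"
    using Z by (auto simp: C.subspace_def S.add S.scale S.zero C.scale_right_distrib mult.commute
      simp del: map_prod_simp)
  have TY: "map_prod T T z \<in> ?Y" if "z \<in> ?Y" for z
  proof -
    have "map_prod S S (map_prod T T z) = map_prod T T (map_prod S S z)"
      using that comm by (auto simp: prod_eq_iff)
    then show ?thesis using that T.scale[of \<mu> z] T(2) by (auto simp: mem_Times_iff)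
  qed
  have uY: "u \<in> ?Y" using u by simp
  obtain v \<nu> where v: "v \<in> ?Y" "v \<notin> {0}" "map_prod T T v - cscale \<nu> v \<in> {0}"
    by (rule C.relative_eigenvector[OF linear_complexify[OF T(1)] Y TY z uY u(2)])
  have eq: "map_prod S S v = cscale \<mu> v" "map_prod T T v = cscale \<nu> v" and vW: "v \<in> W \<times> W"
    and "v \<noteq> 0" using v by (auto simp del: map_prod_simp)
  show ?thesis
  proof (rule that[of "fst v" "snd v" "Re \<mu>" "Im \<mu>" "Re \<nu>" "Im \<nu>"])
    show "fst v \<in> W" "snd v \<in> W" using vW by (auto simp: mem_Times_iff)
    show "fst v \<noteq> 0 \<or> snd v \<noteq> 0" using \<open>v \<noteq> 0\<close> by (auto simp: prod_eq_iff)
  qed (use arg_cong[OF eq(1), of fst] arg_cong[OF eq(1), of snd]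
      arg_cong[OF eq(2), of fst] arg_cong[OF eq(2), of snd] in \<open>simp_all add: add.commute\<close>)
qed

text \<open>
For a basis \<open>C\<close> of \<open>W\<close> the map \<open>w \<mapsto> \<Sum>c\<in>C. \<beta> w c c\<close> is an injective endomorphism of \<open>W\<close>, hence
surjective. Using \<open>W\<close> itself as the target avoids a dual space.
\<close>

lemma functional_represented:
  fixes \<beta> :: "'a \<Rightarrow> 'a \<Rightarrow> real"
  assumes \<beta>: "bilinear \<beta>" and W: "subspace W"
    and nondeg: "\<And>w. w \<in> W \<Longrightarrow> (\<And>y. y \<in> W \<Longrightarrow> \<beta> w y = 0) \<Longrightarrow> w = 0"
    and f: "linear f"
  shows "\<exists>w\<in>W. \<forall>y\<in>W. \<beta> w y = f y"
proof -
  obtain C where C: "C \<subseteq> W" "\<not> dependent C" "W \<subseteq> span C"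
    by (rule maximal_independent_subset[of W])
  have fin: "finite C" using finiteI_independent[OF C(2)] .
  have spanC: "span C = W" using span_subspace[OF C(1,3) W] .
  define \<Phi> where "\<Phi> w = (\<Sum>c\<in>C. \<beta> w c *\<^sub>R c)" for w
  have lin: "linear \<Phi>"
    by (rule linearI) (simp_all add: \<Phi>_def bilinear_ladd[OF \<beta>] bilinear_lmul[OF \<beta>]
        scaleR_left_distrib sum.distrib scaleR_sum_right)
  have im: "\<Phi> w \<in> W" for w
    unfolding \<Phi>_def using C(1) W by (intro subspace_sum subspace_scale) auto
  have agree: "\<beta> w y = g y" if "linear g" "\<And>c. c \<in> C \<Longrightarrow> \<beta> w c = g c" "y \<in> W" for w y and g :: "'a \<Rightarrow> real"
  proof -
    have "y \<in> span C" using that spanC by simp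
    moreover have "linear (\<beta> w)" using \<beta> by (simp add: bilinear_def)
    ultimately show ?thesis using Real_Vector_Spaces.linear_eq_on_span[of "\<beta> w" g C y] that by blast
  qed
  have "inj_on \<Phi> W"
    unfolding linear_inj_on_iff_eq_0[OF lin W]
  proof (intro ballI impI)
    fix w assume w: "w \<in> W" "\<Phi> w = 0"
    then have "\<And>c. c \<in> C \<Longrightarrow> \<beta> w c = 0"
      using independentD[OF C(2) fin subset_refl, of "\<beta> w"] by (auto simp: \<Phi>_def)
    then have "\<beta> w y = 0" if "y \<in> W" for y
      using agree[OF linear_zero _ that] by blast
    then show "w = 0" using nondeg w by blast
  qed
  then have inj: "inj_on \<Phi> (span C)" using spanC by simp
  have "\<not> dependent (\<Phi> ` C)"
    using linear_independent_injective_image[OF lin _ inj] C(2) by blast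
  moreover have "card (\<Phi> ` C) = dim W"
    using card_image[OF inj_on_subset[OF inj span_superset]] basis_card_eq_dim[OF C(1,3,2)] by simp
  ultimately have "W \<subseteq> span (\<Phi> ` C)"
    using im by (intro card_ge_dim_independent) auto
  then have surj: "W \<subseteq> \<Phi> ` W"
    using linear_span_image[OF lin, of C] spanC by simp
  have "(\<Sum>c\<in>C. f c *\<^sub>R c) \<in> W"
    using C(1) W by (intro subspace_sum subspace_scale) auto
  from subsetD[OF surj this] obtain w where w: "w \<in> W" "\<Phi> w = (\<Sum>c\<in>C. f c *\<^sub>R c)"
    by (rule imageE) (rule that, auto)
  then have "(\<Sum>c\<in>C. (\<beta> w c - f c) *\<^sub>R c) = 0"
    by (simp add: \<Phi>_def scaleR_left_diff_distrib sum_subtractf)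
  then have "\<And>c. c \<in> C \<Longrightarrow> \<beta> w c = f c"
    using independentD[OF C(2) fin subset_refl, of "\<lambda>c. \<beta> w c - f c"] by auto
  then show ?thesis using agree[OF f] w by blast
qed

end

section \<open>The Killing form and the arguments of Cartan and Engel\<close>

locale finite_lie_algebra = lie_algebra bracket + real_space B
  for bracket :: "'a::real_vector \<Rightarrow> 'a \<Rightarrow> 'a" and B :: "'a set"
begin

lemmas bracket_simps =
  bilinear_ladd[OF bilinear_bracket] bilinear_radd[OF bilinear_bracket]
  bilinear_lsub[OF bilinear_bracket] bilinear_rsub[OF bilinear_bracket]
  bilinear_lneg[OF bilinear_bracket] bilinear_rneg[OF bilinear_bracket]
  bilinear_lmul[OF bilinear_bracket] bilinear_rmul[OF bilinear_bracket]
  bilinear_lzero[OF bilinear_bracket] bilinear_rzero[OF bilinear_bracket]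

lemma linear_bracket: "linear (bracket x)"
  using bilinear_bracket by (simp add: bilinear_def)

lemma bracket_skew: "bracket x y = - bracket y x"
proof -
  have "bracket (x + y) (x + y) = bracket x x + bracket x y + (bracket y x + bracket y y)"
    by (simp only: bracket_simps add.assoc) (simp add: algebra_simps)
  then have "bracket x y + bracket y x = 0" by (simp add: bracket_self)
  then show ?thesis by (rule eq_neg_iff_add_eq_0[THEN iffD2])
qed

lemma bracket_derivation: "bracket x (bracket y z) = bracket (bracket x y) z + bracket y (bracket x z)"
proof -
  have "bracket z (bracket x y) = - bracket (bracket x y) z"
    "bracket y (bracket z x) = - bracket y (bracket x z)"
    using bracket_skew[of z "bracket x y"] bracket_skew[of z x] by (simp_all add: bracket_simps)
  then show ?thesis using jacobi[of x y z] by (simp add: algebra_simps)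
qed

lemma bracket_bracket: "bracket (bracket x y) z = bracket x (bracket y z) - bracket y (bracket x z)"
  using bracket_derivation[of x y z] by simp

lemma lie_ideal_right: "lie_ideal bracket I \<Longrightarrow> x \<in> I \<Longrightarrow> bracket x y \<in> I"
  using bracket_skew[of x y] subspace_neg[of I] unfolding lie_ideal_def by metis

definition killing :: "'a \<Rightarrow> 'a \<Rightarrow> real" where
  "killing x y = op_trace (\<lambda>z. bracket x (bracket y z))"

lemma killing_sym: "killing x y = killing y x"
  unfolding killing_def by (rule op_trace_comm[OF linear_bracket linear_bracket])

lemma bilinear_killing: "bilinear killing"
proof -
  have "linear (\<lambda>x. killing x y)" for y
    by (rule linearI) (simp_all add: killing_def bracket_simps op_trace_add op_trace_scale)
  moreover have "linear (\<lambda>y. killing x y)" for x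
    unfolding killing_sym[of x] by fact
  ultimately show ?thesis unfolding bilinear_def by blast
qed

lemmas killing_simps =
  bilinear_ladd[OF bilinear_killing] bilinear_radd[OF bilinear_killing]
  bilinear_lsub[OF bilinear_killing] bilinear_rsub[OF bilinear_killing]
  bilinear_lneg[OF bilinear_killing] bilinear_rneg[OF bilinear_killing]
  bilinear_lmul[OF bilinear_killing] bilinear_rmul[OF bilinear_killing]
  bilinear_lzero[OF bilinear_killing] bilinear_rzero[OF bilinear_killing]

lemma linear_compose_fun: "linear f \<Longrightarrow> linear g \<Longrightarrow> linear (\<lambda>z. f (g z))"
  using linear_compose[of g f] by (simp add: o_def)

lemma killing_invariant: "killing (bracket x y) z = killing x (bracket y z)"
proof -
  have "op_trace (\<lambda>u. bracket y (bracket x (bracket z u)))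
      = op_trace (\<lambda>u. bracket x (bracket z (bracket y u)))"
    by (rule op_trace_comm[OF linear_bracket linear_compose_fun[OF linear_bracket linear_bracket]])
  then show ?thesis
    by (simp add: killing_def bracket_bracket bracket_simps op_trace_diff)
qed

text \<open>
This is \<open>tr (\<phi> [ad x, ad y]) = tr ([\<phi>, ad x] ad y)\<close> together with \<open>[\<phi>, ad x] = ad (\<phi> x)\<close>.
\<close>

lemma derivation_trace_bracket:
  assumes \<phi>: "linear \<phi>" and der: "\<And>x y. \<phi> (bracket x y) = bracket (\<phi> x) y + bracket x (\<phi> y)"
  shows "op_trace (\<lambda>z. \<phi> (bracket (bracket x y) z)) = killing (\<phi> x) y"
proof -
  have "op_trace (\<lambda>z. \<phi> (bracket y (bracket x z))) = op_trace (\<lambda>z. bracket x (\<phi> (bracket y z)))"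
    by (rule op_trace_comm[OF linear_compose_fun[OF \<phi> linear_bracket] linear_bracket])
  then have "op_trace (\<lambda>z. \<phi> (bracket (bracket x y) z))
     = op_trace (\<lambda>z. \<phi> (bracket x (bracket y z)) - bracket x (\<phi> (bracket y z)))"
    by (simp add: bracket_bracket linear_diff[OF \<phi>] op_trace_diff)
  also have "\<dots> = killing (\<phi> x) y" by (simp add: killing_def der)
  finally show ?thesis .
qed

text \<open>
For every derivation \<open>\<phi>\<close> the functional \<open>u \<mapsto> tr (\<phi> ad u)\<close> vanishes on the brackets in question,
because its value at \<open>[x, y]\<close> is, up to sign, the Killing form of \<open>x\<close> and \<open>\<phi> y\<close>. If \<open>ad a\<close> were
not nilpotent, some \<open>\<phi>\<close> would give a nonzero value at \<open>a\<close>.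
\<close>

lemma cartan_nilpotent:
  assumes I: "\<And>x y. x \<in> I \<Longrightarrow> killing x y = 0"
    and a: "a \<in> span {bracket x y | x y. x \<in> I}"
  shows "\<exists>n. (bracket a ^^ n) z = 0"
proof (rule ccontr)
  assume "\<not> ?thesis"
  then have nonnil: "(bracket a ^^ n) z \<noteq> 0" for n by blast
  obtain \<phi> where \<phi>: "linear \<phi>" "\<And>x y. \<phi> (bracket x y) = bracket (\<phi> x) y + bracket x (\<phi> y)"
    "op_trace (\<lambda>x. \<phi> (bracket a x)) \<noteq> 0"
    by (rule nonnilpotent_derivation_pairing[OF bilinear_bracket linear_bracket bracket_derivation nonnil]) (rule that)
  have "op_trace (\<lambda>z. \<phi> (bracket a z)) = 0"
    using a
  proof (induction rule: span_induct_alt)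
    case base
    have "op_trace (\<lambda>z. \<phi> (bracket 0 z)) = op_trace (\<lambda>z. 0)"
      by (simp only: bracket_simps linear_0[OF \<phi>(1)])
    also have "\<dots> = 0" using op_trace_diff[of "\<lambda>z. z" "\<lambda>z. z"] by simp
    finally show ?case .
  next
    case (step c u v)
    then obtain x y where u: "u = bracket x y" "x \<in> I" by auto
    then have "u = bracket (- y) x" using bracket_skew[of x y] by (simp add: bracket_simps)
    then have "op_trace (\<lambda>z. \<phi> (bracket u z)) = killing (\<phi> (- y)) x"
      using derivation_trace_bracket[OF \<phi>(1,2)] by simp
    also have "\<dots> = 0" unfolding killing_sym[of _ x] by (rule I[OF u(2)])
    finally have u0: "op_trace (\<lambda>z. \<phi> (bracket u z)) = 0" .
    have "op_trace (\<lambda>z. \<phi> (bracket (c *\<^sub>R u + v) z))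
        = op_trace (\<lambda>z. c *\<^sub>R \<phi> (bracket u z) + \<phi> (bracket v z))"
      by (simp only: bracket_simps linear_add[OF \<phi>(1)] linear_cmul[OF \<phi>(1)])
    also have "\<dots> = 0" by (simp only: op_trace_add op_trace_scale u0 step add_0_right mult_zero_right)
    finally show ?case .
  qed
  then show False using \<phi>(3) by simp
qed

text \<open>
Engel's theorem for the adjoint action of \<open>K\<close> on \<open>W\<close> modulo \<open>W'\<close>. The relative form lets the
induction on the dimension apply to \<open>K\<close> acting on itself modulo a maximal proper subalgebra \<open>L\<close>:
it provides \<open>y\<close> normalizing \<open>L\<close> with \<open>K = L + \<real> y\<close>. The space of vectors of \<open>W\<close> that \<open>L\<close> maps
into \<open>W'\<close> is then invariant under \<open>y\<close>, and the nilpotent operator \<open>ad y\<close> moves such a vector to the last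
place before it enters \<open>W'\<close>.
\<close>

lemma engel_relative:
  assumes K: "subspace K" "\<And>x y. x \<in> K \<Longrightarrow> y \<in> K \<Longrightarrow> bracket x y \<in> K"
    and nil: "\<And>x z. x \<in> K \<Longrightarrow> \<exists>n. (bracket x ^^ n) z = 0"
    and W: "subspace W" "\<And>x w. x \<in> K \<Longrightarrow> w \<in> W \<Longrightarrow> bracket x w \<in> W"
    and W': "subspace W'" "\<And>x w. x \<in> K \<Longrightarrow> w \<in> W' \<Longrightarrow> bracket x w \<in> W'"
    and "W' \<subset> W"
  shows "\<exists>v\<in>W - W'. \<forall>x\<in>K. bracket x v \<in> W'"
  using assms
proof (induction "dim K" arbitrary: K W W' rule: less_induct)
  case less
  show ?case
  proof (cases "K = {0}")
    case True
    obtain v where "v \<in> W - W'" using less.prems by blast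
    then show ?thesis using True subspace_0[OF less.prems(6)] by (auto simp: bracket_simps)
  next
    case False
    define P where "P L \<longleftrightarrow> subspace L \<and> L \<subset> K \<and> (\<forall>x\<in>L. \<forall>y\<in>L. bracket x y \<in> L)" for L
    have "P {0}" using False subspace_0[OF less.prems(1)] by (auto simp: P_def subspace_0 bracket_simps)
    moreover have "\<forall>L. P L \<longrightarrow> dim L < Suc dimension"
      using dim_subset_UNIV by (simp add: less_Suc_eq_le)
    ultimately obtain L where L: "P L" and max: "\<And>L'. P L' \<Longrightarrow> dim L' \<le> dim L"
      using ex_has_greatest_nat[of P "{0}" dim "Suc dimension"] by blast
    have Ls: "subspace L" "L \<subset> K" "\<And>x y. x \<in> L \<Longrightarrow> y \<in> L \<Longrightarrow> bracket x y \<in> L"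
      using L by (auto simp: P_def)
    have lt: "dim L < dim K"
      using dim_psubset[of L K] Ls less.prems(1) span_eq_iff by metis
    obtain y where y: "y \<in> K - L" "\<And>x. x \<in> L \<Longrightarrow> bracket x y \<in> L"
      using less.hyps[OF lt Ls(1,3) less.prems(3) less.prems(1,2) Ls(1,3,2)] Ls(2) by blast
    \<comment> \<open>\<open>L + \<real> y\<close> is a subalgebra properly containing \<open>L\<close>,
      so it is all of \<open>K\<close>.\<close>
    have decomp: "\<exists>l k. l \<in> L \<and> x = l + k *\<^sub>R y" if "x \<in> K" for x
    proof -
      let ?L = "span (insert y L)"
      have mem: "x \<in> ?L \<longleftrightarrow> (\<exists>k. x - k *\<^sub>R y \<in> L)" for x
        using span_breakdown_eq[of x y L] Ls(1) by (simp add: span_eq_iff[THEN iffD2])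
      have sub: "?L \<subseteq> K" using span_minimal[of "insert y L" K] Ls y less.prems(1) by auto
      have "bracket u v \<in> ?L" if uv: "u \<in> ?L" "v \<in> ?L" for u v
      proof -
        obtain k m where km: "u - k *\<^sub>R y \<in> L" "v - m *\<^sub>R y \<in> L" using uv mem by auto
        let ?u = "u - k *\<^sub>R y" and ?v = "v - m *\<^sub>R y"
        have "bracket u v = bracket ?u ?v + m *\<^sub>R bracket ?u y - k *\<^sub>R bracket ?v y"
          using bracket_skew[of y v] by (simp add: bracket_simps bracket_self algebra_simps)
        also have "\<dots> \<in> L" using km Ls y(2) by (intro subspace_add subspace_diff subspace_scale) auto
        finally show ?thesis by (auto intro: span_base)
      qed
      moreover have "dim L < dim ?L"
      proof -
        have "span L \<subset> span (insert y L)"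
        proof
          show "span L \<subseteq> span (insert y L)" by (rule span_mono) auto
          show "span L \<noteq> span (insert y L)"
            using y(1) span_base[of y "insert y L"] unfolding span_eq_iff[THEN iffD2, OF Ls(1)] by auto
        qed
        then have "dim L < dim (insert y L)" by (rule dim_psubset)
        then show ?thesis by simp
      qed
      ultimately have "?L = K" using max[of ?L] sub by (auto simp: P_def psubset_eq)
      then show ?thesis using mem that by (metis diff_add_cancel)
    qed
    have "\<exists>v\<in>W - W'. \<forall>x\<in>L. bracket x v \<in> W'"
      using less.prems Ls by (intro less.hyps[OF lt]) auto
    then obtain w0 where w0: "w0 \<in> W - W'" "\<And>x. x \<in> L \<Longrightarrow> bracket x w0 \<in> W'" by blast
    let ?w = "\<lambda>n. (bracket y ^^ n) w0"
    have "\<exists>n. ?w n \<in> W'"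
    proof -
      obtain n where "?w n = 0" using less.prems(3)[of y w0] y(1) by blast
      then show ?thesis using subspace_0[OF less.prems(6)] by (intro exI[of _ n]) simp
    qed
    moreover have "?w 0 \<notin> W'" using w0 by simp
    ultimately obtain n where n: "?w n \<notin> W'" "?w (Suc n) \<in> W'"
      using ex_least_nat_less[of "\<lambda>n. ?w n \<in> W'"] by (metis Suc_n_not_le_n not_le_imp_less le_refl)
    have inv: "?w n \<in> W \<and> (\<forall>x\<in>L. bracket x (?w n) \<in> W')" for n
    proof (induction n)
      case 0
      then show ?case using w0 by simp
    next
      case (Suc n)
      have "bracket x (bracket y (?w n)) \<in> W'" if "x \<in> L" for x
        using bracket_derivation[of x y "?w n"] y Suc less.prems(6,7) that subspace_add by auto
      then show ?case using Suc less.prems(5) y by auto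
    qed
    have "bracket x (?w n) \<in> W'" if "x \<in> K" for x
      using decomp[OF that] inv[of n] n(2) less.prems(6)
      by (auto simp: bracket_simps intro!: subspace_add subspace_scale)
    then show ?thesis using inv n by blast
  qed
qed

definition abelian :: "'a set \<Rightarrow> bool" where
  "abelian I \<longleftrightarrow> (\<forall>x\<in>I. \<forall>y\<in>I. bracket x y = 0)"

lemma lie_ideal_brackets:
  assumes "lie_ideal bracket I"
  shows "lie_ideal bracket (span {bracket x y | x y. x \<in> I})"
proof -
  let ?G = "{bracket x y | x y. x \<in> I}"
  have "bracket z u \<in> span ?G" if "u \<in> span ?G" for z u
    using that
  proof (induction rule: span_induct_alt)
    case base
    then show ?case by (simp add: bracket_simps span_zero)
  next
    case (step c u v)
    then obtain x y where u: "u = bracket x y" "x \<in> I" by auto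
    have "bracket z u = bracket (bracket z x) y + bracket x (bracket z y)"
      unfolding u by (rule bracket_derivation)
    moreover have "bracket z x \<in> I" using assms u by (auto simp: lie_ideal_def)
    then have "bracket (bracket z x) y \<in> span ?G" "bracket x (bracket z y) \<in> span ?G"
      using u(2) by (auto intro: span_base)
    ultimately have "bracket z u \<in> span ?G" by (simp add: span_add)
    then show ?case using step by (simp add: bracket_simps span_add span_scale)
  qed
  then show ?thesis by (auto simp: lie_ideal_def)
qed

lemma lie_ideal_centre:
  assumes "lie_ideal bracket M"
  shows "lie_ideal bracket {v\<in>M. \<forall>x\<in>M. bracket x v = 0}"
proof -
  have "bracket x (bracket z v) = 0" if "v \<in> M" "\<forall>x\<in>M. bracket x v = 0" "x \<in> M" for x z v
    using that bracket_derivation[of x z v] lie_ideal_right[OF assms] by (simp add: bracket_simps)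
  then show ?thesis
    using assms by (auto simp: lie_ideal_def subspace_def bracket_simps)
qed

text \<open>
The span \<open>M\<close> of the brackets of \<open>I\<close> with the whole algebra is an ideal all of whose elements are
nilpotent by Cartan's argument. If \<open>M = 0\<close>, then \<open>I\<close> is central; otherwise Engel's theorem makes
the centre of \<open>M\<close> nonzero.
\<close>

lemma abelian_ideal_in_killing_kernel:
  assumes I: "lie_ideal bracket I" "I \<noteq> {0}" and K: "\<And>x y. x \<in> I \<Longrightarrow> killing x y = 0"
  shows "\<exists>A\<subseteq>I. lie_ideal bracket A \<and> abelian A \<and> A \<noteq> {0}"
proof -
  let ?M = "span {bracket x y | x y. x \<in> I}"
  have M: "lie_ideal bracket ?M" using lie_ideal_brackets[OF I(1)] .
  have MI: "?M \<subseteq> I"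
    using I(1) lie_ideal_right[OF I(1)] by (intro span_minimal) (auto simp: lie_ideal_def)
  show ?thesis
  proof (cases "?M = {0}")
    case True
    then have "abelian I" using span_base[of _ "{bracket x y | x y. x \<in> I}"]
      by (fastforce simp: abelian_def)
    then show ?thesis using I by blast
  next
    case False
    let ?Z = "{v\<in>?M. \<forall>x\<in>?M. bracket x v = 0}"
    have nil: "\<exists>n. (bracket x ^^ n) z = 0" if "x \<in> ?M" for x z
      using cartan_nilpotent[OF K that] .
    have Ms: "subspace ?M" "\<And>x y. x \<in> ?M \<Longrightarrow> y \<in> ?M \<Longrightarrow> bracket x y \<in> ?M"
      using M by (auto simp: lie_ideal_def)
    have "\<exists>v\<in>?M - {0}. \<forall>x\<in>?M. bracket x v \<in> {0}"
      using False subspace_0[OF Ms(1)]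
      by (intro engel_relative[OF Ms(1,2) nil Ms(1,2)]) (auto simp: bracket_simps)
    then have "?Z \<noteq> {0}" by auto
    moreover have "?Z \<subseteq> I" using MI by blast
    moreover have "abelian ?Z" by (auto simp: abelian_def)
    ultimately show ?thesis using lie_ideal_centre[OF M] by blast
  qed
qed

end

section \<open>Ideals and orthogonality in symplectic Lie algebras\<close>

locale finite_symplectic = finite_lie_algebra bracket B + symplectic_lie_algebra bracket \<omega>
  for bracket :: "'a::real_vector \<Rightarrow> 'a \<Rightarrow> 'a" and B :: "'a set" and \<omega>
begin

lemmas form_simps =
  bilinear_ladd[OF bilinear_form] bilinear_radd[OF bilinear_form]
  bilinear_lsub[OF bilinear_form] bilinear_rsub[OF bilinear_form]
  bilinear_lneg[OF bilinear_form] bilinear_rneg[OF bilinear_form]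
  bilinear_lmul[OF bilinear_form] bilinear_rmul[OF bilinear_form]
  bilinear_lzero[OF bilinear_form] bilinear_rzero[OF bilinear_form]

lemma form_self: "\<omega> x x = 0"
  using form_skew[of x x] by simp

text \<open>
A symplectic Lie algebra has no semisimple ideals. Suppose \<open>k\<close> contains no nonzero abelian ideal.
Then it does not meet the kernel of the Killing form \<open>\<kappa>\<close>, and the part of \<open>k\<close> that is
\<open>\<kappa>\<close>-orthogonal to \<open>k\<close> is abelian, so \<open>\<kappa>\<close> is nondegenerate on \<open>k\<close>. Hence \<open>\<omega> x y = \<kappa> (D x) y\<close>
for \<open>y\<close> in \<open>k\<close> with a map \<open>D\<close> into \<open>k\<close>, which is a derivation because \<open>\<omega>\<close> is closed. The usual
argument that derivations of semisimple algebras are inner gives \<open>D = ad z\<close> with \<open>z\<close> in \<open>k\<close>. But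
then \<open>\<omega> x z = \<kappa> [z, x] z = 0\<close> for all \<open>x\<close>, so \<open>z = 0\<close>, \<open>D = 0\<close> and \<open>k = 0\<close>.
\<close>

lemma ideal_contains_abelian_ideal:
  assumes k: "lie_ideal bracket k" "k \<noteq> {0}"
  shows "\<exists>A\<subseteq>k. lie_ideal bracket A \<and> abelian A \<and> A \<noteq> {0}"
proof (rule ccontr)
  assume "\<not> ?thesis"
  then have none: "A = {0}" if "A \<subseteq> k" "lie_ideal bracket A" "abelian A" for A
    using that by blast
  have ks: "subspace k" using k by (simp add: lie_ideal_def)
  have kl: "bracket x y \<in> k" if "y \<in> k" for x y using k that by (simp add: lie_ideal_def)
  have kr: "bracket x y \<in> k" if "x \<in> k" for x y using lie_ideal_right[OF k(1) that] .
  \<comment> \<open>Invariance in the form in which it shows that orthogonal subspaces of ideals are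
    ideals.\<close>
  have swap: "killing (bracket z x) y = - killing x (bracket z y)" for x y z
    by (simp add: bracket_skew[of z x] killing_simps killing_invariant)
  let ?I = "{x\<in>k. \<forall>y. killing x y = 0}" and ?J = "{x\<in>k. \<forall>y\<in>k. killing x y = 0}"
  have I: "lie_ideal bracket ?I"
    using ks by (auto simp: lie_ideal_def subspace_def killing_simps kl swap)
  have I0: "?I = {0}"
  proof (rule ccontr)
    assume "?I \<noteq> {0}"
    from abelian_ideal_in_killing_kernel[OF I this]
    obtain A where A: "A \<subseteq> ?I" "lie_ideal bracket A" "abelian A" "A \<noteq> {0}" by auto
    then have "A \<subseteq> k" by blast
    then show False using none A(2-4) by simp
  qed
  have "lie_ideal bracket ?J"
    using ks by (auto simp: lie_ideal_def subspace_def killing_simps kl swap)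
  moreover have "abelian ?J"
  proof -
    have "bracket x w \<in> ?I" if "x \<in> ?J" "w \<in> ?J" for x w
      using that kr by (auto simp: killing_invariant)
    then show ?thesis unfolding I0 abelian_def by blast
  qed
  ultimately have J0: "?J = {0}" by (intro none) auto
  have nondeg: "w = 0" if "w \<in> k" "\<And>y. y \<in> k \<Longrightarrow> killing w y = 0" for w
    using J0 that by blast
  have eqI: "u = v" if "u \<in> k" "v \<in> k" "\<And>y. y \<in> k \<Longrightarrow> killing u y = killing v y" for u v
    using nondeg[of "u - v"] that ks by (simp add: killing_simps subspace_diff)
  have "\<exists>D. \<forall>x. D x \<in> k \<and> (\<forall>y\<in>k. killing (D x) y = \<omega> x y)"
  proof (rule choice, rule allI)
    fix x
    have "linear (\<omega> x)" using bilinear_form by (simp add: bilinear_def)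
    from functional_represented[OF bilinear_killing ks nondeg this]
    show "\<exists>w. w \<in> k \<and> (\<forall>y\<in>k. killing w y = \<omega> x y)" by blast
  qed
  then obtain D where Dk: "D x \<in> k" and D: "y \<in> k \<Longrightarrow> killing (D x) y = \<omega> x y" for x y by blast
  have linD: "linear D"
  proof (rule linearI)
    show "D (x + y) = D x + D y" for x y
      by (rule eqI) (auto simp: Dk D ks subspace_add killing_simps form_simps)
    show "D (c *\<^sub>R x) = c *\<^sub>R D x" for c x
      by (rule eqI) (auto simp: Dk D ks subspace_scale killing_simps form_simps)
  qed
  have derD: "D (bracket x y) = bracket (D x) y + bracket x (D y)" for x y
  proof (rule eqI)
    fix w assume w: "w \<in> k"
    have "killing (bracket (D x) y + bracket x (D y)) w = \<omega> x (bracket y w) - \<omega> y (bracket x w)"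
      using w by (simp add: killing_simps bracket_skew[of x "D y"])
        (simp add: killing_invariant D kl)
    also have "\<dots> = - \<omega> (bracket y w) x - \<omega> (bracket w x) y"
      by (simp add: form_skew[of x "bracket y w"] form_skew[of y "bracket x w"]
          bracket_skew[of w x] form_simps)
    also have "\<dots> = \<omega> (bracket x y) w"
      using form_closed[of x y w] by simp
    finally show "killing (D (bracket x y)) w = killing (bracket (D x) y + bracket x (D y)) w"
      using w by (simp add: D)
  qed (auto simp: Dk ks subspace_add kl kr)
  have "linear (\<lambda>y. op_trace (\<lambda>u. D (bracket y u)))"
    by (rule linearI) (simp_all add: bracket_simps linear_add[OF linD] linear_cmul[OF linD]
        op_trace_add op_trace_scale)
  \<comment> \<open>The element \<open>z\<close> represents \<open>y \<mapsto> tr (D ad y)\<close>, so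
    the derivation \<open>D - ad z\<close> has trace zero against \<open>ad k\<close>, which forces it
    to vanish.\<close>
  from functional_represented[OF bilinear_killing ks nondeg this]
  obtain z where z: "z \<in> k" "\<And>y. y \<in> k \<Longrightarrow> killing z y = op_trace (\<lambda>u. D (bracket y u))"
    by blast
  define E where "E x = D x - bracket z x" for x
  have linE: "linear E"
    unfolding E_def by (rule linear_compose_sub[OF linD linear_bracket])
  have derE: "E (bracket x y) = bracket (E x) y + bracket x (E y)" for x y
    using bracket_derivation[of z x y] by (simp add: E_def derD bracket_simps)
  have trE: "op_trace (\<lambda>u. E (bracket y u)) = 0" if "y \<in> k" for y
    using z(2)[OF that] by (simp add: E_def op_trace_diff killing_def)
  have "E x = 0" for x
  proof (rule nondeg)
    show "E x \<in> k" by (simp add: E_def Dk kr z(1) ks subspace_diff)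
    fix y assume "y \<in> k"
    then show "killing (E x) y = 0"
      using derivation_trace_bracket[OF linE derE, of x y] trE[OF kl, of y x] by simp
  qed
  then have Dz: "D x = bracket z x" for x by (simp add: E_def)
  have "\<omega> z x = 0" for x
  proof -
    have "\<omega> x z = killing (bracket z x) z" using D[OF z(1), of x] by (simp add: Dz)
    also have "\<dots> = 0" by (simp add: swap bracket_self killing_simps)
    finally show ?thesis using form_skew[of z x] by simp
  qed
  then have "z = 0" by (rule form_nondegenerate)
  then have "\<omega> x y = 0" if "y \<in> k" for x y
    using D[OF that, of x] by (simp add: Dz bracket_simps killing_simps)
  then have "y = 0" if "y \<in> k" for y
    using that form_nondegenerate[of y] form_skew[of y] by simp
  then show False using k(2) subspace_0[OF ks] by blast
qed

definition perp :: "'a set \<Rightarrow> 'a set" where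
  "perp W = {x. \<forall>y\<in>W. \<omega> x y = 0}"

definition nondegenerate_on :: "'a set \<Rightarrow> bool" where
  "nondegenerate_on W \<longleftrightarrow> W \<inter> perp W \<subseteq> {0}"

lemma subspace_perp: "subspace (perp W)"
  by (auto simp: perp_def subspace_def form_simps)

lemma nondegenerate_onD:
  "nondegenerate_on W \<Longrightarrow> w \<in> W \<Longrightarrow> (\<And>y. y \<in> W \<Longrightarrow> \<omega> w y = 0) \<Longrightarrow> w = 0"
  by (auto simp: nondegenerate_on_def perp_def)

lemma orthogonal_decomposition:
  assumes "subspace W" "nondegenerate_on W"
  obtains u v where "u \<in> W" "v \<in> perp W" "z = u + v"
proof -
  have "linear (\<omega> z)" using bilinear_form by (simp add: bilinear_def)
  from functional_represented[OF bilinear_form assms(1) nondegenerate_onD[OF assms(2)] this]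
  obtain u where u: "u \<in> W" "\<And>y. y \<in> W \<Longrightarrow> \<omega> u y = \<omega> z y" by blast
  then have "z - u \<in> perp W" by (simp add: perp_def form_simps)
  then show ?thesis using that[of u "z - u"] u by simp
qed

lemma nondegenerate_on_perp:
  assumes "subspace W" "nondegenerate_on W"
  shows "nondegenerate_on (perp W)"
  unfolding nondegenerate_on_def
proof
  fix w assume w: "w \<in> perp W \<inter> perp (perp W)"
  have "\<omega> w z = 0" for z
  proof -
    obtain u v where "u \<in> W" "v \<in> perp W" "z = u + v"
      using orthogonal_decomposition[OF assms] .
    then show ?thesis using w by (auto simp: perp_def form_simps)
  qed
  then show "w \<in> {0}" using form_nondegenerate by simp
qed

lemma nonzero_pairing:
  assumes "nondegenerate_on W" "subspace W" "W \<noteq> {0}"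
  obtains x y where "x \<in> W" "y \<in> W" "\<omega> x y \<noteq> 0"
proof -
  obtain x where "x \<in> W" "x \<noteq> 0" using assms(3) subspace_0[OF assms(2)] by blast
  then show ?thesis using nondegenerate_onD[OF assms(1)] that by blast
qed

text \<open>
Every vector is a combination of the hyperbolic pair \<open>x, y\<close> plus a vector orthogonal to both.
\<close>

lemma hyperbolic_split:
  assumes "\<omega> x y \<noteq> 0"
  shows "\<exists>\<alpha> \<beta>. \<omega> (w - \<alpha> *\<^sub>R x - \<beta> *\<^sub>R y) x = 0 \<and> \<omega> (w - \<alpha> *\<^sub>R x - \<beta> *\<^sub>R y) y = 0"
  using assms form_skew[of y x]
  by (intro exI[of _ "\<omega> w y / \<omega> x y"] exI[of _ "\<omega> w x / \<omega> y x"])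
    (simp add: form_simps form_self)

lemma nondegenerate_on_complement:
  assumes W: "subspace W" "nondegenerate_on W" and xy: "x \<in> W" "y \<in> W" "\<omega> x y \<noteq> 0"
  shows "nondegenerate_on {w\<in>W. \<omega> w x = 0 \<and> \<omega> w y = 0}" (is "nondegenerate_on ?W")
  unfolding nondegenerate_on_def
proof
  fix w assume w: "w \<in> ?W \<inter> perp ?W"
  have "\<omega> w z = 0" if z: "z \<in> W" for z
  proof -
    obtain \<alpha> \<beta> where *: "\<omega> (z - \<alpha> *\<^sub>R x - \<beta> *\<^sub>R y) x = 0" "\<omega> (z - \<alpha> *\<^sub>R x - \<beta> *\<^sub>R y) y = 0"
      using hyperbolic_split[OF xy(3), of z] by blast
    then have "z - \<alpha> *\<^sub>R x - \<beta> *\<^sub>R y \<in> ?W"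
      using z xy W(1) by (simp add: subspace_diff subspace_scale)
    then have "\<omega> w (z - \<alpha> *\<^sub>R x - \<beta> *\<^sub>R y) = 0" using w by (simp add: perp_def)
    then show ?thesis using w by (simp add: form_simps)
  qed
  then show "w \<in> {0}" using nondegenerate_onD[OF W(2), of w] w by simp
qed

lemma subspace_complement: "subspace W \<Longrightarrow> subspace {w\<in>W. \<omega> w x = 0 \<and> \<omega> w y = 0}"
  by (auto simp: subspace_def form_simps)

text \<open>
Pairing a linear relation among the \<open>e i\<close> with \<open>d j\<close> isolates its \<open>j\<close>-th coefficient.
\<close>

lemma indexed_basis_if_dual:
  fixes e d :: "nat \<Rightarrow> 'a"
  assumes n: "dimension = n"
    and dual: "\<And>i. i \<in> {1..n} \<Longrightarrow> \<omega> (e i) (d i) \<noteq> 0"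
      "\<And>i j. i \<in> {1..n} \<Longrightarrow> j \<in> {1..n} \<Longrightarrow> i \<noteq> j \<Longrightarrow> \<omega> (e i) (d j) = 0"
  shows "indexed_basis n e"
proof -
  have inj: "inj_on e {1..n}"
    using dual by (metis inj_onI)
  have indep: "\<not> dependent (e ` {1..n})"
  proof
    assume "dependent (e ` {1..n})"
    then obtain u where u: "\<exists>v\<in>e ` {1..n}. u v \<noteq> 0" "(\<Sum>v\<in>e ` {1..n}. u v *\<^sub>R v) = 0"
      using dependent_finite[of "e ` {1..n}"] by auto
    then obtain i where i: "i \<in> {1..n}" "u (e i) \<noteq> 0" by auto
    have lin: "linear (\<lambda>x. \<omega> x (d i))" using bilinear_form by (simp add: bilinear_def)
    have "0 = \<omega> (\<Sum>v\<in>e ` {1..n}. u v *\<^sub>R v) (d i)" using u(2) by (simp add: form_simps)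
    also have "\<dots> = (\<Sum>v\<in>e ` {1..n}. u v * \<omega> v (d i))"
      by (simp add: linear_sum[OF lin] form_simps)
    also have "\<dots> = (\<Sum>j\<in>{1..n}. u (e j) * \<omega> (e j) (d i))"
      by (rule sum.reindex[OF inj, unfolded o_def])
    also have "\<dots> = (\<Sum>j\<in>{i}. u (e j) * \<omega> (e j) (d i))"
      using i dual(2) by (intro sum.mono_neutral_right) auto
    finally show False using i dual(1) by simp
  qed
  have "dim (UNIV :: 'a set) \<le> card (e ` {1..n})"
    using card_image[OF inj] n dim_UNIV by (simp add: dimension_def)
  then have "span (e ` {1..n}) = UNIV"
    using card_ge_dim_independent[OF _ indep, of UNIV] by auto
  then show ?thesis unfolding indexed_basis_def using inj indep by simp
qed

end

lemma common_zero_of_five_functionals: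
  fixes f1 f2 f3 f4 f5 :: "'a::real_vector \<Rightarrow> real"
  assumes "linear f1" "linear f2" "linear f3" "linear f4" "linear f5"
    and B: "independent (B :: 'a set)" "card B > 5"
  shows "\<exists>x. x \<noteq> 0 \<and> f1 x = 0 \<and> f2 x = 0 \<and> f3 x = 0 \<and> f4 x = 0 \<and> f5 x = 0"
proof (rule ccontr)
  assume none: "\<not> ?thesis"
  define F where "F x = (f1 x, f2 x, f3 x, f4 x, f5 x)" for x
  have lin: "linear F"
    by (rule linearI) (simp_all add: F_def assms(1-5) linear_add linear_cmul)
  have "inj F"
    unfolding linear_injective_0[OF lin] using none by (auto simp: F_def zero_prod_def)
  then have "inj_on F (span B)" by (rule inj_on_subset[OF _ subset_UNIV])
  then have "independent (F ` B)" by (rule linear_independent_injective_image[OF lin B(1)])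
  from independent_bound[OF this] have "card (F ` B) \<le> 5" by simp
  moreover have "card (F ` B) = card B" by (rule card_image[OF inj_on_subset[OF \<open>inj F\<close> subset_UNIV]])
  ultimately show False using B(2) by simp
qed

section \<open>Structure of symplectically irreducible algebras\<close>

locale irreducible_symplectic = finite_symplectic bracket B \<omega>
  for bracket :: "'a::real_vector \<Rightarrow> 'a \<Rightarrow> 'a" and B :: "'a set" and \<omega> +
  assumes irreducible: "lie_ideal bracket I \<Longrightarrow> isotropic \<omega> I \<Longrightarrow> I = {0}"
    and nontrivial: "(UNIV :: 'a set) \<noteq> {0}"
begin

text \<open>
By the closedness of \<open>\<omega>\<close>, the radical of \<open>\<omega>\<close> restricted to an abelian ideal is itself an ideal,
and it is isotropic.
\<close>

lemma abelian_ideal_nondegenerate: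
  assumes a: "lie_ideal bracket a" "abelian a"
  shows "nondegenerate_on a"
proof -
  have as: "subspace a" "\<And>x y. y \<in> a \<Longrightarrow> bracket x y \<in> a" using a by (auto simp: lie_ideal_def)
  have "\<omega> (bracket x w) y = 0" if w: "w \<in> a" "w \<in> perp a" and y: "y \<in> a" for x w y
  proof -
    have "\<omega> (bracket y x) w = - \<omega> w (bracket y x)" by (rule form_skew)
    also have "\<dots> = 0" using w lie_ideal_right[OF a(1) y] by (simp add: perp_def)
    finally show ?thesis
      using form_closed[of x w y] a(2) w y by (simp add: abelian_def form_simps)
  qed
  then have "lie_ideal bracket (a \<inter> perp a)"
    using subspace_inter[OF as(1) subspace_perp] as(2) by (auto simp: lie_ideal_def perp_def)
  moreover have "isotropic \<omega> (a \<inter> perp a)" by (auto simp: isotropic_def perp_def)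
  ultimately show ?thesis using irreducible unfolding nondegenerate_on_def by blast
qed

definition maximal_abelian :: "'a set \<Rightarrow> bool" where
  "maximal_abelian a \<longleftrightarrow> lie_ideal bracket a \<and> abelian a \<and>
     (\<forall>b. lie_ideal bracket b \<longrightarrow> abelian b \<longrightarrow> a \<subseteq> b \<longrightarrow> b = a)"

lemma maximal_abelian_exists:
  obtains a where "maximal_abelian a" "a \<noteq> {0}"
proof -
  define P where "P A \<longleftrightarrow> lie_ideal bracket A \<and> abelian A \<and> A \<noteq> {0}" for A
  have "lie_ideal bracket UNIV" by (simp add: lie_ideal_def)
  from ideal_contains_abelian_ideal[OF this nontrivial] obtain A0 where "P A0"
    by (auto simp: P_def)
  moreover have "\<forall>A. P A \<longrightarrow> dim A < Suc dimension"
    using dim_subset_UNIV by (simp add: less_Suc_eq_le)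
  ultimately obtain a where a: "P a" and max: "\<And>A. P A \<Longrightarrow> dim A \<le> dim a"
    using ex_has_greatest_nat[of P A0 dim "Suc dimension"] by blast
  have "b = a" if b: "lie_ideal bracket b" "abelian b" "a \<subseteq> b" for b
  proof -
    have "0 \<in> a" using a subspace_0[of a] by (auto simp: P_def lie_ideal_def)
    then have "b \<noteq> {0}" using a b(3) by (auto simp: P_def)
    then have "dim b \<le> dim a" using max b by (simp add: P_def)
    then have "a = b"
      using a b by (intro subspace_dim_equal) (auto simp: P_def lie_ideal_def)
    then show ?thesis by simp
  qed
  then show ?thesis using that[of a] a by (auto simp: P_def maximal_abelian_def)
qed

context
  fixes a assumes max: "maximal_abelian a" and a0: "a \<noteq> {0}"
begin

lemma maximal_abelian_facts:
  "lie_ideal bracket a" "abelian a" "subspace a" "nondegenerate_on a"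
  using max abelian_ideal_nondegenerate[of a] by (auto simp: maximal_abelian_def lie_ideal_def)

lemma a_closed: "y \<in> a \<Longrightarrow> bracket x y \<in> a" "x \<in> a \<Longrightarrow> bracket x y \<in> a"
  using maximal_abelian_facts(1) lie_ideal_right[OF maximal_abelian_facts(1)] by (auto simp: lie_ideal_def)

lemma a_commute: "x \<in> a \<Longrightarrow> y \<in> a \<Longrightarrow> bracket x y = 0"
  using maximal_abelian_facts(2) by (auto simp: abelian_def)

lemma perp_a: "x \<in> perp a \<Longrightarrow> y \<in> a \<Longrightarrow> \<omega> x y = 0" "x \<in> perp a \<Longrightarrow> y \<in> a \<Longrightarrow> \<omega> y x = 0"
  using form_skew[of y x] by (auto simp: perp_def)

lemma perp_closed: "u \<in> perp a \<Longrightarrow> v \<in> perp a \<Longrightarrow> bracket u v \<in> perp a"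
proof -
  assume uv: "u \<in> perp a" "v \<in> perp a"
  have "\<omega> (bracket u v) y = 0" if "y \<in> a" for y
    using form_closed[of u v y] perp_a[OF uv(1) a_closed(1)[OF that, of v]]
      perp_a[OF uv(2) a_closed(2)[OF that, of u]] by simp
  then show ?thesis by (simp add: perp_def)
qed

text \<open>
Since the ideal is abelian, closedness of \<open>\<omega>\<close> says that every element acts on it by an
infinitesimally symplectic map.
\<close>

lemma symplectic_action:
  assumes "x \<in> a" "y \<in> a"
  shows "\<omega> (bracket u x) y = - \<omega> x (bracket u y)"
  using form_closed[of u x y] a_commute[OF assms] bracket_skew[of y u] form_skew[of "bracket u y" x]
  by (simp add: form_simps)

lemma decomposition: obtains u v where "u \<in> a" "v \<in> perp a" "z = u + v"
  using orthogonal_decomposition[OF maximal_abelian_facts(3,4)] by blast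

text \<open>
The elements of the complement that commute with \<open>a\<close> form an ideal. If it were nonzero, it would
contain a nonzero abelian ideal \<open>b\<close>, and \<open>a + b\<close> would be an abelian ideal larger than \<open>a\<close>.
\<close>

lemma faithful:
  assumes x: "x \<in> perp a" "\<And>y. y \<in> a \<Longrightarrow> bracket x y = 0"
  shows "x = 0"
proof (rule ccontr)
  assume "x \<noteq> 0"
  let ?K = "{x \<in> perp a. \<forall>y\<in>a. bracket x y = 0}"
  have "lie_ideal bracket ?K"
  proof -
    have "bracket z k \<in> ?K" if k: "k \<in> ?K" for z k
    proof -
      obtain u v where uv: "u \<in> a" "v \<in> perp a" "z = u + v" by (rule decomposition)
      have "bracket u k = 0" using bracket_skew[of u k] k uv by simp
      then have eq: "bracket z k = bracket v k" using uv by (simp add: bracket_simps)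
      have "bracket (bracket v k) y = 0" if "y \<in> a" for y
        using k that a_closed by (simp add: bracket_bracket bracket_simps)
      then show ?thesis unfolding eq using k uv(2) perp_closed by simp
    qed
    moreover have "subspace ?K"
      using subspace_perp[of a] by (auto simp: subspace_def bracket_simps)
    ultimately show ?thesis by (simp add: lie_ideal_def)
  qed
  moreover have "?K \<noteq> {0}" using x \<open>x \<noteq> 0\<close> by blast
  ultimately have "\<exists>b\<subseteq>?K. lie_ideal bracket b \<and> abelian b \<and> b \<noteq> {0}"
    by (rule ideal_contains_abelian_ideal)
  then obtain b where b: "b \<subseteq> ?K" "lie_ideal bracket b" "abelian b" "b \<noteq> {0}" by auto
  have bs: "subspace b" "\<And>x y. y \<in> b \<Longrightarrow> bracket x y \<in> b" using b by (auto simp: lie_ideal_def)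
  have ba: "bracket x y = 0" "bracket y x = 0" if "x \<in> b" "y \<in> a" for x y
    using that b(1) bracket_skew[of y x] by auto
  let ?s = "{u + v | u v. u \<in> a \<and> v \<in> b}"
  have "lie_ideal bracket ?s"
    using subspace_sums[OF maximal_abelian_facts(3) bs(1)] a_closed bs(2)
    by (fastforce simp: lie_ideal_def bracket_simps)
  moreover have "abelian ?s"
    using ba a_commute b(3) by (auto simp: abelian_def bracket_simps)
  moreover have "a \<subseteq> ?s" using subspace_0[OF bs(1)] by force
  ultimately have "?s = a" using max by (simp add: maximal_abelian_def)
  moreover have "b \<subseteq> ?s" using subspace_0[OF maximal_abelian_facts(3)] by force
  ultimately have "b \<subseteq> a \<inter> perp a" using b(1) by blast
  then have "b \<subseteq> {0}" using maximal_abelian_facts(4) unfolding nondegenerate_on_def by blast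
  then show False using b(4) subspace_0[OF bs(1)] by blast
qed

text \<open>
If \<open>a\<close> were spanned by \<open>u\<close> and \<open>v\<close>, an element \<open>x\<close> orthogonal to \<open>a\<close> would act on \<open>a\<close> through a
symplectic \<open>2 \<times> 2\<close> matrix, which is determined by three numbers. Orthogonality and trivial action
thus amount to five linear conditions on \<open>x\<close>, so a six-dimensional space contains a nonzero
solution, contrary to faithfulness.
\<close>

lemma not_plane:
  assumes dim: "dimension = 6" and uv: "u \<in> a" "v \<in> a"
  shows "\<not> a \<subseteq> span {u, v}"
proof
  assume plane: "a \<subseteq> span {u, v}"
  have lin: "linear (\<lambda>x. \<omega> x y)" "linear (\<lambda>x. \<omega> (bracket x y) z)" for y z
    by (auto intro!: linearI simp: form_simps bracket_simps)
  have "card B > 5" using dim by (simp add: dimension_def)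
  from common_zero_of_five_functionals[OF lin(1)[of u] lin(1)[of v] lin(2)[of u u] lin(2)[of u v]
      lin(2)[of v v] independent_B this]
  obtain x where x: "x \<noteq> 0" "\<omega> x u = 0" "\<omega> x v = 0" "\<omega> (bracket x u) u = 0"
    "\<omega> (bracket x u) v = 0" "\<omega> (bracket x v) v = 0" by blast
  have vanish: "f y = 0" if "linear f" "f u = 0" "f v = 0" "y \<in> a" for f :: "'a \<Rightarrow> real" and y
    using that plane Real_Vector_Spaces.linear_eq_0_on_span[of f "{u, v}" y] by blast
  have "x \<in> perp a"
    using vanish[of "\<omega> x"] x bilinear_form by (simp add: perp_def bilinear_def)
  moreover have "bracket x y = 0" if "y \<in> a" for y
  proof -
    have zero: "bracket x w = 0" if "w \<in> a" "\<omega> (bracket x w) u = 0" "\<omega> (bracket x w) v = 0" for w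
      using nondegenerate_onD[OF maximal_abelian_facts(4) a_closed(1)[OF that(1)]] vanish[of "\<omega> (bracket x w)"]
        that(2,3) bilinear_form by (simp add: bilinear_def)
    have "\<omega> (bracket x v) u = 0"
      using symplectic_action[OF uv(2,1), of x] form_skew[of v "bracket x u"] x by simp
    then have "bracket x u = 0" "bracket x v = 0" using zero uv x by auto
    moreover have "y \<in> span {u, v}" using that plane by blast
    ultimately show ?thesis
      using Real_Vector_Spaces.linear_eq_0_on_span[of "bracket x" "{u, v}" y] linear_bracket by blast
  qed
  ultimately show False using faithful x(1) by blast
qed

lemma orthogonal_pair:
  assumes dim: "dimension = 6" and xy: "x \<in> a" "y \<in> a" "\<omega> x y \<noteq> 0"
  shows "{w\<in>a. \<omega> w x = 0 \<and> \<omega> w y = 0} \<noteq> {0}"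
proof
  assume W: "{w\<in>a. \<omega> w x = 0 \<and> \<omega> w y = 0} = {0}"
  have "w \<in> span {x, y}" if w: "w \<in> a" for w
  proof -
    obtain \<alpha> \<beta> where *: "\<omega> (w - \<alpha> *\<^sub>R x - \<beta> *\<^sub>R y) x = 0" "\<omega> (w - \<alpha> *\<^sub>R x - \<beta> *\<^sub>R y) y = 0"
      using hyperbolic_split[OF xy(3), of w] by blast
    have "w - \<alpha> *\<^sub>R x - \<beta> *\<^sub>R y \<in> a" using w xy maximal_abelian_facts(3) by (simp add: subspace_diff subspace_scale)
    then have "w - \<alpha> *\<^sub>R x - \<beta> *\<^sub>R y \<in> {0}" using * W by blast
    then have "w = \<alpha> *\<^sub>R x + \<beta> *\<^sub>R y" by (simp add: algebra_simps)
    then show ?thesis by (simp add: span_add span_scale span_base)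
  qed
  then show False using not_plane[OF dim xy(1,2)] by blast
qed

text \<open>
Three mutually orthogonal hyperbolic pairs; each vector is dual to its partner.
\<close>

lemma six_basis:
  assumes dim: "dimension = 6"
    and pq: "p \<in> perp a" "q \<in> perp a" "\<omega> p q \<noteq> 0"
    and xy: "x \<in> a" "y \<in> a" "\<omega> x y \<noteq> 0"
    and xy': "x' \<in> a" "y' \<in> a" "\<omega> x' y' \<noteq> 0"
    and orth: "\<omega> x' x = 0" "\<omega> x' y = 0" "\<omega> y' x = 0" "\<omega> y' y = 0"
    and e: "e 1 = p" "e 2 = q" "e 3 = x" "e 4 = y" "e 5 = x'" "e 6 = y'"
  shows "indexed_basis 6 e"
proof (rule indexed_basis_if_dual[OF dim])
  define d where "d i = [q, p, y, x, y', x'] ! (i - 1)" for i :: nat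
  have I: "{1..6::nat} = {1, 2, 3, 4, 5, 6}" by auto
  have d: "d 1 = q" "d 2 = p" "d 3 = y" "d 4 = x" "d 5 = y'" "d 6 = x'"
    by (simp_all add: d_def)
  have skew: "\<omega> q p = - \<omega> p q" "\<omega> y x = - \<omega> x y" "\<omega> y' x' = - \<omega> x' y'"
    "\<omega> x x' = 0" "\<omega> y x' = 0" "\<omega> x y' = 0" "\<omega> y y' = 0"
    using form_skew[of q p] form_skew[of y x] form_skew[of y' x'] form_skew[of x x']
      form_skew[of y x'] form_skew[of x y'] form_skew[of y y'] orth by auto
  show "\<omega> (e i) (d i) \<noteq> 0" if "i \<in> {1..6}" for i
    using that pq(3) xy(3) xy'(3) skew(1-3) unfolding I
    by (elim insertE) (simp_all add: e d del: One_nat_def)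
  show "\<omega> (e i) (d j) = 0" if "i \<in> {1..6}" "j \<in> {1..6}" "i \<noteq> j" for i j
    using that unfolding I
    by (elim insertE) (simp_all add: e d orth skew form_self perp_a pq xy xy' del: One_nat_def)
qed

lemma six_basis_vanish:
  assumes "dimension = 6"
    and "p \<in> perp a" "q \<in> perp a" "\<omega> p q \<noteq> 0"
    and "x \<in> a" "y \<in> a" "\<omega> x y \<noteq> 0"
    and "x' \<in> a" "y' \<in> a" "\<omega> x' y' \<noteq> 0"
    and "\<omega> x' x = 0" "\<omega> x' y = 0" "\<omega> y' x = 0" "\<omega> y' y = 0"
    and w: "\<omega> w p = 0" "\<omega> w q = 0" "\<omega> w x = 0" "\<omega> w y = 0" "\<omega> w x' = 0" "\<omega> w y' = 0"
  shows "w = 0"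
proof -
  define e where "e i = [p, q, x, y, x', y'] ! (i - 1)" for i :: nat
  have I: "{1..6::nat} = {1, 2, 3, 4, 5, 6}" by auto
  have "indexed_basis 6 e"
    by (rule six_basis[OF assms(1-14)]) (simp_all add: e_def)
  then have "span (e ` {1..6}) = UNIV" by (simp add: indexed_basis_def)
  moreover have "\<omega> w v = 0" if "v \<in> e ` {1..6}" for v
    using that w unfolding I by (auto simp: e_def)
  moreover have "linear (\<omega> w)" using bilinear_form by (simp add: bilinear_def)
  ultimately have "\<omega> w v = 0" for v
    using Real_Vector_Spaces.linear_eq_0_on_span[of "\<omega> w" "e ` {1..6}" v] by auto
  then show ?thesis by (rule form_nondegenerate)
qed


text \<open>
As \<open>a\<close> is nondegenerate and larger than a plane, it contains two orthogonal hyperbolic pairs. The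
complement is nonzero and nondegenerate, so it contains a third, which in dimension six exhausts
it.
\<close>

lemma transversal_plane:
  assumes dim: "dimension = 6"
  obtains p q where "p \<in> perp a" "q \<in> perp a" "\<omega> p q \<noteq> 0" "perp a \<subseteq> span {p, q}"
proof -
  obtain x y where xy: "x \<in> a" "y \<in> a" "\<omega> x y \<noteq> 0"
    using nonzero_pairing[OF maximal_abelian_facts(4,3) a0] by blast
  let ?W = "{w\<in>a. \<omega> w x = 0 \<and> \<omega> w y = 0}"
  obtain x' y' where "x' \<in> ?W" "y' \<in> ?W" and xy'0: "\<omega> x' y' \<noteq> 0"
    using nonzero_pairing[OF nondegenerate_on_complement[OF maximal_abelian_facts(3,4) xy]
        subspace_complement[OF maximal_abelian_facts(3)] orthogonal_pair[OF dim xy]] by blast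
  then have xy': "x' \<in> a" "y' \<in> a" "\<omega> x' y' \<noteq> 0"
    and orth: "\<omega> x' x = 0" "\<omega> x' y = 0" "\<omega> y' x = 0" "\<omega> y' y = 0" by auto
  \<comment> \<open>Otherwise the whole algebra would be abelian, and every line an isotropic
    ideal.\<close>
  have "perp a \<noteq> {0}"
  proof
    assume h0: "perp a = {0}"
    have all: "z \<in> a" for z
    proof -
      obtain u v where "u \<in> a" "v \<in> perp a" "z = u + v" by (rule decomposition)
      then show ?thesis using h0 by simp
    qed
    then have "lie_ideal bracket (span {x})"
      using a_commute span_zero[of "{x}"] by (simp add: lie_ideal_def)
    moreover have "isotropic \<omega> (span {x})"
      by (auto simp: isotropic_def span_singleton form_simps form_self)
    ultimately have "span {x} = {0}" by (rule irreducible)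
    then have "x = 0" using span_base[of x "{x}"] by simp
    then show False using xy(3) by (simp add: form_simps)
  qed
  then obtain p q where pq: "p \<in> perp a" "q \<in> perp a" "\<omega> p q \<noteq> 0"
    using nonzero_pairing[OF nondegenerate_on_perp[OF maximal_abelian_facts(3,4)] subspace_perp] by blast
  have "w \<in> span {p, q}" if w: "w \<in> perp a" for w
  proof -
    obtain \<alpha> \<beta> where *: "\<omega> (w - \<alpha> *\<^sub>R p - \<beta> *\<^sub>R q) p = 0" "\<omega> (w - \<alpha> *\<^sub>R p - \<beta> *\<^sub>R q) q = 0"
      using hyperbolic_split[OF pq(3), of w] by blast
    let ?w = "w - \<alpha> *\<^sub>R p - \<beta> *\<^sub>R q"
    have "?w \<in> perp a" using w pq subspace_perp by (simp add: subspace_diff subspace_scale)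
    then have "\<omega> ?w v = 0" if "v \<in> a" for v using that by (rule perp_a(1))
    then have "?w = 0"
      using xy(1,2) xy'(1,2) by (intro six_basis_vanish[OF dim pq xy xy' orth *])
    then have "w = \<alpha> *\<^sub>R p + \<beta> *\<^sub>R q" by (simp add: algebra_simps)
    then show ?thesis by (simp add: span_add span_scale span_base)
  qed
  then show ?thesis using that pq by blast
qed

context
  fixes p q
  assumes pq: "p \<in> perp a" "q \<in> perp a" "\<omega> p q \<noteq> 0" "perp a \<subseteq> span {p, q}"
begin

lemma transversal_coordinates:
  assumes "w \<in> perp a" obtains \<alpha> \<beta> where "w = \<alpha> *\<^sub>R p + \<beta> *\<^sub>R q"
proof -
  have "w \<in> span {p, q}" using assms pq by blast
  then obtain \<alpha> \<beta> where "w - \<alpha> *\<^sub>R p = \<beta> *\<^sub>R q"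
    by (auto simp: span_breakdown_eq span_singleton)
  then have "w = \<alpha> *\<^sub>R p + \<beta> *\<^sub>R q" by (simp add: algebra_simps)
  then show ?thesis by (rule that)
qed

lemma invariant_subspace_ideal:
  assumes V: "subspace V" "V \<subseteq> a"
    and inv: "\<And>v. v \<in> V \<Longrightarrow> bracket p v \<in> V" "\<And>v. v \<in> V \<Longrightarrow> bracket q v \<in> V"
  shows "lie_ideal bracket V"
  unfolding lie_ideal_def
proof (intro conjI allI ballI V(1))
  fix z v assume v: "v \<in> V"
  obtain u w where z: "u \<in> a" "w \<in> perp a" "z = u + w" by (rule decomposition)
  obtain \<alpha> \<beta> where w: "w = \<alpha> *\<^sub>R p + \<beta> *\<^sub>R q" using transversal_coordinates[OF z(2)] by blast
  have "bracket u v = 0" using v V(2) z(1) a_commute by blast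
  then have "bracket z v = \<alpha> *\<^sub>R bracket p v + \<beta> *\<^sub>R bracket q v"
    by (simp add: z(3) w bracket_simps)
  then show "bracket z v \<in> V" using inv[OF v] V(1) by (simp add: subspace_add subspace_scale)
qed

lemma annihilating_operator_zero:
  assumes r: "r = \<alpha> *\<^sub>R p + \<beta> *\<^sub>R q" and zero: "\<And>y. y \<in> a \<Longrightarrow> bracket r y = 0"
  shows "\<alpha> = 0 \<and> \<beta> = 0"
proof -
  have "r \<in> perp a" using r pq subspace_perp by (simp add: subspace_add subspace_scale)
  then have "r = 0" using zero by (rule faithful)
  then have "\<omega> r q = 0" "\<omega> p r = 0" by (simp_all add: form_simps)
  then show ?thesis using pq(3) by (simp add: r form_simps form_self)
qed

text \<open>
Let \<open>r = [p, q]\<close>, a combination of \<open>p\<close> and \<open>q\<close>. Invariance shows that \<open>r\<close> is in the kernel of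
the Killing form, and if \<open>r \<noteq> 0\<close> then \<open>r\<close> is a multiple of \<open>[r, p]\<close> or of \<open>[r, q]\<close>; so \<open>ad r\<close> is
nilpotent. The kernel \<open>K\<close> of \<open>r\<close> on \<open>a\<close> is an abelian ideal, hence nondegenerate. Its orthogonal
complement in \<open>a\<close> is invariant under \<open>r\<close>, and a nilpotent map on it without kernel exists only
if it is zero. So \<open>r\<close> commutes with \<open>a\<close>, and faithfulness gives \<open>r = 0\<close>.
\<close>

lemma transversal_commute: "bracket p q = 0"
proof -
  define r where "r = bracket p q"
  have rh: "r \<in> perp a" unfolding r_def using pq perp_closed by blast
  obtain \<alpha> \<beta> where r: "r = \<alpha> *\<^sub>R p + \<beta> *\<^sub>R q" using transversal_coordinates[OF rh] by blast
  have qp: "bracket q p = - r" using bracket_skew[of q p] by (simp add: r_def)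
  have pr: "bracket p r = \<beta> *\<^sub>R r" and qr: "bracket q r = - (\<alpha> *\<^sub>R r)"
    by (subst (1) r, simp add: bracket_simps bracket_self r_def[symmetric] qp)+
  have killing_r: "killing r z = 0" for z
  proof -
    obtain u w where z: "u \<in> a" "w \<in> perp a" "z = u + w" by (rule decomposition)
    obtain \<gamma> \<delta> where w: "w = \<gamma> *\<^sub>R p + \<delta> *\<^sub>R q" using transversal_coordinates[OF z(2)] by blast
    have "killing u r = 0"
      unfolding killing_def
      by (rule op_trace_square_zero[OF linear_compose_fun[OF linear_bracket linear_bracket] maximal_abelian_facts(3)])
        (use z(1) a_closed a_commute in auto)
    then have "killing r u = 0" by (simp add: killing_sym[of r u])
    moreover have "killing r q = 0"
      by (simp add: r_def killing_invariant bracket_self killing_simps)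
    moreover have "killing r p = 0"
    proof -
      have "killing r p = - killing (bracket q p) p" by (simp add: qp killing_simps)
      then show ?thesis by (simp add: killing_invariant bracket_self killing_simps)
    qed
    ultimately show ?thesis by (simp add: z(3) w killing_simps)
  qed
  show ?thesis
  proof (rule ccontr)
    assume "bracket p q \<noteq> 0"
    then have r0: "r \<noteq> 0" by (simp add: r_def)
    let ?I = "{x. \<forall>y. killing x y = 0}"
    have "r \<in> span {bracket x y | x y. x \<in> ?I}" (is "r \<in> span ?G")
    proof -
      have G: "bracket r z \<in> ?G" for z using killing_r by blast
      have rp: "bracket r p = (- \<beta>) *\<^sub>R r" and rq: "bracket r q = \<alpha> *\<^sub>R r"
        using bracket_skew[of r p] bracket_skew[of r q] pr qr by simp_all
      show ?thesis
      proof (cases "\<beta> = 0")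
        case False
        then have "r = (- inverse \<beta>) *\<^sub>R bracket r p" by (simp add: rp)
        then show ?thesis using span_scale[OF span_base[OF G[of p]], of "- inverse \<beta>"] by simp
      next
        case True
        then have "\<alpha> \<noteq> 0" using r r0 by auto
        then have "r = inverse \<alpha> *\<^sub>R bracket r q" by (simp add: rq)
        then show ?thesis using span_scale[OF span_base[OF G[of q]], of "inverse \<alpha>"] by simp
      qed
    qed
    then have nil: "\<exists>n. (bracket r ^^ n) z = 0" for z
      by (rule cartan_nilpotent[rotated]) blast
    define K where "K = {x\<in>a. bracket r x = 0}"
    have Ks: "subspace K"
      using maximal_abelian_facts(3) by (auto simp: K_def subspace_def bracket_simps)
    have Kinv: "bracket p x \<in> K" "bracket q x \<in> K" if "x \<in> K" for x
      using that bracket_derivation[of r p x] bracket_derivation[of r q x] bracket_skew[of r p]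
        bracket_skew[of r q] pr qr a_closed by (auto simp: K_def bracket_simps)
    have "lie_ideal bracket K"
      by (rule invariant_subspace_ideal[OF Ks]) (auto simp: K_def[symmetric] Kinv, simp add: K_def)
    moreover have "abelian K" using a_commute by (auto simp: abelian_def K_def)
    ultimately have Knd: "nondegenerate_on K" by (rule abelian_ideal_nondegenerate)
    have "x \<in> K" if x: "x \<in> a" for x
    proof -
      obtain u w where uw: "u \<in> K" "w \<in> perp K" "x = u + w"
        using orthogonal_decomposition[OF Ks Knd] .
      have wa: "w \<in> a"
        using x uw(1,3) subspace_diff[OF maximal_abelian_facts(3), of x u] by (simp add: K_def)
      have "w = 0"
      proof (rule ccontr)
        assume "w \<noteq> 0"
        have it: "(bracket r ^^ n) w \<in> a \<inter> perp K" for n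
        proof (induction n)
          case 0 then show ?case using wa uw by simp
        next
          case (Suc n)
          let ?v = "(bracket r ^^ n) w"
          have "\<omega> (bracket r ?v) k = 0" if "k \<in> K" for k
            using symplectic_action[of ?v k r] Suc that by (simp add: K_def form_simps)
          then show ?case using Suc a_closed by (simp add: perp_def)
        qed
        obtain n where n: "(bracket r ^^ n) w \<noteq> 0" "(bracket r ^^ Suc n) w = 0"
        proof -
          obtain m where "(bracket r ^^ m) w = 0" using nil by blast
          then obtain k where "\<forall>i\<le>k. (bracket r ^^ i) w \<noteq> 0" "(bracket r ^^ Suc k) w = 0"
            using ex_least_nat_less[of "\<lambda>i. (bracket r ^^ i) w = 0" m] \<open>w \<noteq> 0\<close> by auto
          then show ?thesis using that[of k] by blast
        qed
        have "(bracket r ^^ n) w \<in> K" using it[of n] n(2) by (simp add: K_def)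
        then show False using it[of n] n(1) Knd unfolding nondegenerate_on_def by blast
      qed
      then show ?thesis using uw by simp
    qed
    then have "\<alpha> = 0 \<and> \<beta> = 0"
      by (intro annihilating_operator_zero[OF r]) (simp add: K_def)
    then show False using r0 r by simp
  qed
qed

text \<open>
The real and the imaginary part of a common eigenvector span an ideal, so irreducibility makes
\<open>\<omega> x y\<close> nonzero. As \<open>p\<close> and \<open>q\<close> act by symplectic maps, which are traceless on this plane, the
real parts of the eigenvalues vanish.
\<close>

lemma rotation_plane:
  assumes V: "subspace V" "V \<subseteq> a" "V \<noteq> {0}"
    and inv: "\<And>v. v \<in> V \<Longrightarrow> bracket p v \<in> V" "\<And>v. v \<in> V \<Longrightarrow> bracket q v \<in> V"
  obtains x y \<rho> \<sigma> where "x \<in> V" "y \<in> V" "\<omega> x y \<noteq> 0"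
    "bracket p x = - \<rho> *\<^sub>R y" "bracket p y = \<rho> *\<^sub>R x"
    "bracket q x = - \<sigma> *\<^sub>R y" "bracket q y = \<sigma> *\<^sub>R x"
proof -
  have comm: "bracket p (bracket q x) = bracket q (bracket p x)" for x
    using bracket_derivation[of p q x] by (simp add: transversal_commute bracket_simps)
  obtain x y a1 a2 b1 b2 where xy: "x \<in> V" "y \<in> V" "x \<noteq> 0 \<or> y \<noteq> 0"
    and ev: "bracket p x = a1 *\<^sub>R x - a2 *\<^sub>R y" "bracket p y = a2 *\<^sub>R x + a1 *\<^sub>R y"
      "bracket q x = b1 *\<^sub>R x - b2 *\<^sub>R y" "bracket q y = b2 *\<^sub>R x + b1 *\<^sub>R y"
    by (rule common_eigenplane[OF V(1,3) linear_bracket inv(1) linear_bracket inv(2) comm])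
  have xya: "x \<in> a" "y \<in> a" using xy V(2) by auto
  have pairing: "\<omega> x y \<noteq> 0"
  proof
    assume "\<omega> x y = 0"
    let ?S = "{c *\<^sub>R x + d *\<^sub>R y | c d. True}"
    have "lie_ideal bracket ?S"
    proof (rule invariant_subspace_ideal)
      show "subspace ?S"
        unfolding subspace_def
      proof (intro conjI ballI allI)
        show "0 \<in> ?S" by (auto intro!: exI[of _ 0])
        show "v + w \<in> ?S" if vw: "v \<in> ?S" "w \<in> ?S" for v w
        proof -
          obtain c d c' d' where "v = c *\<^sub>R x + d *\<^sub>R y" "w = c' *\<^sub>R x + d' *\<^sub>R y" using vw by blast
          then have "v + w = (c + c') *\<^sub>R x + (d + d') *\<^sub>R y" by (simp add: algebra_simps)
          then show ?thesis by blast
        qed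
        show "k *\<^sub>R v \<in> ?S" if v: "v \<in> ?S" for k v
        proof -
          obtain c d where "v = c *\<^sub>R x + d *\<^sub>R y" using v by blast
          then have "k *\<^sub>R v = (k * c) *\<^sub>R x + (k * d) *\<^sub>R y" by (simp add: algebra_simps)
          then show ?thesis by blast
        qed
      qed
      show "?S \<subseteq> a" using xya maximal_abelian_facts(3) by (auto intro!: subspace_add subspace_scale)
      show "bracket p v \<in> ?S" if v: "v \<in> ?S" for v
      proof -
        obtain c d where "v = c *\<^sub>R x + d *\<^sub>R y" using v by blast
        then have "bracket p v = (c * a1 + d * a2) *\<^sub>R x + (d * a1 - c * a2) *\<^sub>R y"
          by (simp add: bracket_simps ev algebra_simps)
        then show ?thesis by blast
      qed
      show "bracket q v \<in> ?S" if v: "v \<in> ?S" for v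
      proof -
        obtain c d where "v = c *\<^sub>R x + d *\<^sub>R y" using v by blast
        then have "bracket q v = (c * b1 + d * b2) *\<^sub>R x + (d * b1 - c * b2) *\<^sub>R y"
          by (simp add: bracket_simps ev algebra_simps)
        then show ?thesis by blast
      qed
    qed
    moreover have "isotropic \<omega> ?S"
      using \<open>\<omega> x y = 0\<close> form_skew[of y x]
      by (auto simp: isotropic_def form_simps form_self)
    ultimately have S0: "?S = {0}" by (rule irreducible)
    have "1 *\<^sub>R x + 0 *\<^sub>R y \<in> ?S" "0 *\<^sub>R x + 1 *\<^sub>R y \<in> ?S" by blast+
    then show False using xy(3) unfolding S0 by simp
  qed
  have "a1 = 0"
    using symplectic_action[OF xya, of p] pairing by (simp add: ev form_simps form_self)
  moreover have "b1 = 0"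
    using symplectic_action[OF xya, of q] pairing by (simp add: ev form_simps form_self)
  ultimately show ?thesis
    using that[of x y a2 b2] xy pairing ev by simp
qed

text \<open>
The elements \<open>p\<close> and \<open>q\<close> rotate a plane spanned by \<open>x, y\<close> and an orthogonal plane spanned by
\<open>x', y'\<close>. By faithfulness the matrix of the four rotation speeds is invertible, so suitable
combinations \<open>e1, e2\<close> of \<open>p, q\<close> rotate only one of the planes, with unit speed.
\<close>

lemma standard_basis:
  assumes dim: "dimension = 6"
  shows "\<exists>e :: nat \<Rightarrow> 'a. indexed_basis 6 e \<and>
    bracket (e 1) (e 3) = e 4 \<and>
    bracket (e 1) (e 4) = - e 3 \<and>
    bracket (e 2) (e 5) = e 6 \<and>
    bracket (e 2) (e 6) = - e 5 \<and>
    (\<forall>i\<in>{1..6}. \<forall>j\<in>{1..6}. i < j \<longrightarrow>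
       (i, j) \<notin> {(1, 3), (1, 4), (2, 5), (2, 6)} \<longrightarrow> bracket (e i) (e j) = 0)"
proof -
  obtain x y \<rho> \<sigma> where xy: "x \<in> a" "y \<in> a" "\<omega> x y \<noteq> 0"
    and act: "bracket p x = - \<rho> *\<^sub>R y" "bracket p y = \<rho> *\<^sub>R x"
      "bracket q x = - \<sigma> *\<^sub>R y" "bracket q y = \<sigma> *\<^sub>R x"
    using rotation_plane[OF maximal_abelian_facts(3) subset_refl a0 a_closed(1) a_closed(1)] by blast
  let ?V = "{w\<in>a. \<omega> w x = 0 \<and> \<omega> w y = 0}"
  have inv: "bracket z w \<in> ?V"
    if w: "w \<in> ?V" and z: "bracket z x = - c *\<^sub>R y" "bracket z y = c *\<^sub>R x" for z c w
    using w symplectic_action[of w x z] symplectic_action[of w y z] xy a_closed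
    by (simp add: z form_simps)
  obtain x' y' \<rho>' \<sigma>' where "x' \<in> ?V" "y' \<in> ?V" and xy'0: "\<omega> x' y' \<noteq> 0"
    and act': "bracket p x' = - \<rho>' *\<^sub>R y'" "bracket p y' = \<rho>' *\<^sub>R x'"
      "bracket q x' = - \<sigma>' *\<^sub>R y'" "bracket q y' = \<sigma>' *\<^sub>R x'"
    using rotation_plane[OF subspace_complement[OF maximal_abelian_facts(3)] _ orthogonal_pair[OF dim xy]
        inv[OF _ act(1,2)] inv[OF _ act(3,4)]] by blast
  then have xy': "x' \<in> a" "y' \<in> a" "\<omega> x' y' \<noteq> 0"
    and orth: "\<omega> x' x = 0" "\<omega> x' y = 0" "\<omega> y' x = 0" "\<omega> y' y = 0" by auto
  define D where "D = \<rho> * \<sigma>' - \<sigma> * \<rho>'"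
  \<comment> \<open>A combination of \<open>p\<close> and \<open>q\<close> with both speeds zero
    commutes with \<open>a\<close>, since both planes together with the complement span.\<close>
  have kill: "s = 0 \<and> t = 0" if st: "s * \<rho> + t * \<sigma> = 0" "s * \<rho>' + t * \<sigma>' = 0" for s t
  proof (rule annihilating_operator_zero[OF refl])
    let ?r = "s *\<^sub>R p + t *\<^sub>R q"
    have "bracket ?r x = - (s * \<rho> + t * \<sigma>) *\<^sub>R y" "bracket ?r y = (s * \<rho> + t * \<sigma>) *\<^sub>R x"
      "bracket ?r x' = - (s * \<rho>' + t * \<sigma>') *\<^sub>R y'" "bracket ?r y' = (s * \<rho>' + t * \<sigma>') *\<^sub>R x'"
      by (simp_all add: bracket_simps act act' algebra_simps)
    then have r0: "bracket ?r x = 0" "bracket ?r y = 0" "bracket ?r x' = 0" "bracket ?r y' = 0"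
      using st by simp_all
    fix w assume w: "w \<in> a"
    have "\<omega> (bracket ?r w) v = 0" if "v \<in> a" "bracket ?r v = 0" for v
      using symplectic_action[OF w that(1), of ?r] that(2) by (simp add: form_simps)
    then show "bracket ?r w = 0"
      using r0 xy xy' perp_a(2)[OF pq(1) a_closed(1)[OF w]] perp_a(2)[OF pq(2) a_closed(1)[OF w]]
      by (intro six_basis_vanish[OF dim pq(1-3) xy xy' orth]) auto
  qed
  have D: "D \<noteq> 0"
  proof
    assume "D = 0"
    then have "\<sigma> = 0 \<and> \<rho> = 0" "\<sigma>' = 0 \<and> \<rho>' = 0"
      using kill[of \<sigma> "- \<rho>"] kill[of \<sigma>' "- \<rho>'"] by (auto simp: D_def algebra_simps)
    then show False using kill[of 1 0] by simp
  qed
  \<comment> \<open>The coefficients come from the inverse of the matrix of speeds, whose determinant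
    is \<open>D\<close>; the sign makes \<open>e1\<close> map \<open>x\<close> to \<open>y\<close>
    rather than to \<open>- y\<close>.\<close>
  define e1 where "e1 = (- \<sigma>' / D) *\<^sub>R p + (\<rho>' / D) *\<^sub>R q"
  define e2 where "e2 = (\<sigma> / D) *\<^sub>R p + (- \<rho> / D) *\<^sub>R q"
  have comb: "bracket (s *\<^sub>R p + t *\<^sub>R q) x = - (s * \<rho> + t * \<sigma>) *\<^sub>R y"
    "bracket (s *\<^sub>R p + t *\<^sub>R q) y = (s * \<rho> + t * \<sigma>) *\<^sub>R x"
    "bracket (s *\<^sub>R p + t *\<^sub>R q) x' = - (s * \<rho>' + t * \<sigma>') *\<^sub>R y'"
    "bracket (s *\<^sub>R p + t *\<^sub>R q) y' = (s * \<rho>' + t * \<sigma>') *\<^sub>R x'" for s t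
    by (simp_all add: bracket_simps act act' algebra_simps)
  have coeffs: "- \<sigma>' / D * \<rho> + \<rho>' / D * \<sigma> = - 1" "- \<sigma>' / D * \<rho>' + \<rho>' / D * \<sigma>' = 0"
    "\<sigma> / D * \<rho> + - \<rho> / D * \<sigma> = 0" "\<sigma> / D * \<rho>' + - \<rho> / D * \<sigma>' = - 1"
    using D by (simp_all add: field_simps) (simp_all add: D_def)
  have br1: "bracket e1 x = y" "bracket e1 y = - x" "bracket e1 x' = 0" "bracket e1 y' = 0"
    unfolding e1_def comb coeffs by simp_all
  have br2: "bracket e2 x = 0" "bracket e2 y = 0" "bracket e2 x' = y'" "bracket e2 y' = - x'"
    unfolding e2_def comb coeffs by simp_all
  have qp: "bracket q p = 0" using bracket_skew[of q p] by (simp add: transversal_commute)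
  have br12: "bracket e1 e2 = 0"
    by (simp add: e1_def e2_def bracket_simps bracket_self transversal_commute qp)
  have eh: "e1 \<in> perp a" "e2 \<in> perp a"
    unfolding e1_def e2_def using pq subspace_perp by (auto intro!: subspace_add subspace_diff subspace_scale)
  have "\<omega> e1 e2 = ((\<rho> * \<sigma>' - \<sigma> * \<rho>') / (D * D)) * \<omega> p q"
    using form_skew[of q p]
    by (simp add: e1_def e2_def form_simps form_self diff_divide_distrib algebra_simps)
  then have e12: "\<omega> e1 e2 \<noteq> 0" using D pq(3) by (simp add: D_def[symmetric])
  define e where "e i = [e1, e2, x, y, x', y'] ! (i - 1)" for i :: nat
  have e: "e 1 = e1" "e 2 = e2" "e 3 = x" "e 4 = y" "e 5 = x'" "e 6 = y'"
    by (simp_all add: e_def)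
  have I: "{1..6::nat} = {1, 2, 3, 4, 5, 6}" by auto
  have "indexed_basis 6 e"
    by (rule six_basis[OF dim eh e12 xy xy' orth e])
  moreover have "bracket (e i) (e j) = 0"
    if "i \<in> {1..6}" "j \<in> {1..6}" "i < j" "(i, j) \<notin> {(1, 3), (1, 4), (2, 5), (2, 6)}" for i j
    using that unfolding I
    by (elim insertE) (simp_all add: e br1 br2 br12 a_commute xy xy' del: One_nat_def)
  ultimately show ?thesis
    using e br1 br2 by (intro exI[of _ e]) (simp del: One_nat_def)
qed

end

end

end

section \<open>The six-dimensional case\<close>

theorem proposition6p2:
  fixes bracket :: "'a::real_vector \<Rightarrow> 'a \<Rightarrow> 'a"
    and \<omega> :: "'a \<Rightarrow> 'a \<Rightarrow> real"
  assumes "symplectic_lie_algebra bracket \<omega>"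
    and "symplectically_irreducible bracket \<omega>"
    and "dim (UNIV :: 'a set) = 6"
  shows "\<exists>e :: nat \<Rightarrow> 'a. indexed_basis 6 e \<and>
    bracket (e 1) (e 3) = e 4 \<and>
    bracket (e 1) (e 4) = - e 3 \<and>
    bracket (e 2) (e 5) = e 6 \<and>
    bracket (e 2) (e 6) = - e 5 \<and>
    (\<forall>i\<in>{1..6}. \<forall>j\<in>{1..6}. i < j \<longrightarrow>
       (i, j) \<notin> {(1, 3), (1, 4), (2, 5), (2, 6)} \<longrightarrow> bracket (e i) (e j) = 0)"
proof -
  obtain B :: "'a set" where B: "B \<subseteq> UNIV" "independent B" "UNIV \<subseteq> span B"
    "card B = dim (UNIV :: 'a set)"
    by (rule basis_exists)
  have fin: "finite B" using B(4) assms(3) by (intro card_ge_0_finite) simp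
  interpret S: symplectic_lie_algebra bracket \<omega> by (rule assms(1))
  interpret irreducible_symplectic bracket B \<omega>
  proof unfold_locales
    show "finite B" "independent B" "span B = UNIV" using fin B by auto
    show "I = {0}" if "lie_ideal bracket I" "isotropic \<omega> I" for I
      using assms(2) that by (auto simp: symplectically_irreducible_def)
    show "(UNIV :: 'a set) \<noteq> {0}"
    proof
      assume "(UNIV :: 'a set) = {0}"
      then have "dim (UNIV :: 'a set) \<le> card ({} :: 'a set)"
        by (intro dim_le_card) (simp_all only: span_empty subset_refl finite.emptyI)
      then show False using assms(3) by simp
    qed
  qed
  have six: "dimension = 6" using B(4) assms(3) by (simp add: dimension_def)
  obtain a where a: "maximal_abelian a" "a \<noteq> {0}" by (rule maximal_abelian_exists)
  obtain p q where pq: "p \<in> perp a" "q \<in> perp a" "\<omega> p q \<noteq> 0" "perp a \<subseteq> span {p, q}"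
    by (rule transversal_plane[OF a six])
  show ?thesis by (rule standard_basis[OF a pq six])
qed

end
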